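(* Let $k\geq1$ and $d\geq 1$ be fixed integers, and let $g_k(n,d)$ be the maximum number of hyperedges of a $k$-uniform hypergraph on $n$ vertices that has a convex embedding into $\mathbb{R}^d$. With all asymptotics taken as $n\to\infty$: (1) If $d\geq 2k$, then $g_k(n,d)=\binom{n}{k}$. (2) If $k+1\leq d\leq 2k-1$, then $g_k(n,d)\in\Theta(n^k)$. More precisely, $g_k(n,d)=\gamma_{k,d}\cdot n^k+o(n^k)$ for some constant $\gamma_{k,d}$ satisfying $$\binom{d}{k}\frac{1}{d^k}\leq\gamma_{k,d}\leq\frac{1}{k!}\left(1-\frac{1}{\binom{n_{k,d}}{k-1}}\right),$$ where, for $d\neq 1$, $$n_{k,d}=\begin{cases} d+2 &\text{if } d\geq 2k-3,\\ \left\lfloor\frac d2\right\rfloor+k &\text{if } 1\leq d\leq 2k-4,\end{cases}$$ and $n_{1,1}=2$, $n_{k,1}=k$ for $k\geq 2$. (3) If $d\leq k$, then $g_k(n,d)\in\Omega(n^{d-1})$.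
   Context: A $k$-uniform hypergraph is a pair $H=(V,E)$ with $V$ a finite set and $E\subseteq\binom{V}{k}$. A convex embedding of $H$ into $\mathbb{R}^d$ is an injective map $f:V\to\mathbb{R}^d$ such that the points $\frac1k\sum_{v\in e}f(v)$, indexed by the hyperedges $e\in E$, are in convex position, i.e. the points indexed by different hyperedges are distinct and none of them is a convex combination of the others. *)

theory Defs
  imports "HOL-Analysis.Analysis" "HOL-Library.Landau_Symbols"
begin

definition uniform_hypergraph :: "nat \<Rightarrow> 'v set \<Rightarrow> 'v set set \<Rightarrow> bool" where
  "uniform_hypergraph k V E \<longleftrightarrow> finite V \<and> E \<subseteq> {e. e \<subseteq> V \<and> card e = k}"

definition barycenter :: "nat \<Rightarrow> ('v \<Rightarrow> 'a::real_vector) \<Rightarrow> 'v set \<Rightarrow> 'a" where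
  "barycenter k f e = (1 / real k) *\<^sub>R (\<Sum>v\<in>e. f v)"

definition convex_position :: "('i \<Rightarrow> 'a::real_vector) \<Rightarrow> 'i set \<Rightarrow> bool" where
  "convex_position p I \<longleftrightarrow>
     inj_on p I \<and> (\<forall>i\<in>I. p i \<notin> convex hull (p ` (I - {i})))"

definition convex_embedding ::
    "nat \<Rightarrow> 'v set \<Rightarrow> 'v set set \<Rightarrow> ('v \<Rightarrow> 'a::real_vector) \<Rightarrow> bool" where
  "convex_embedding k V E f \<longleftrightarrow> inj_on f V \<and> convex_position (barycenter k f) E"

text \<open>The possible numbers of hyperedges. Taking the vertices to be natural numbers loses
  no generality, since only finite vertex sets occur. The dimension \<open>d\<close> is \<open>CARD('d)\<close>; it is
  passed as a type argument.\<close>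

definition edge_counts :: "'d::finite itself \<Rightarrow> nat \<Rightarrow> nat \<Rightarrow> nat set" where
  "edge_counts _ k n =
     {card E | (V :: nat set) E. uniform_hypergraph k V E \<and> card V = n \<and>
        (\<exists>f :: nat \<Rightarrow> real ^ 'd. convex_embedding k V E f)}"

definition max_edges :: "'d::finite itself \<Rightarrow> nat \<Rightarrow> nat \<Rightarrow> nat" where
  "max_edges D k n = Max (edge_counts D k n)"

text \<open>The maximum is attained: \<open>Max\<close> is applied to a finite nonempty set.\<close>

lemma finite_edge_counts: "finite (edge_counts D k n)"
proof (rule finite_subset)
  show "edge_counts D k n \<subseteq> {..n choose k}"
  proof
    fix m assume "m \<in> edge_counts D k n"
    then obtain V :: "nat set" and E where
      "m = card E" "finite V" "E \<subseteq> {e. e \<subseteq> V \<and> card e = k}" "card V = n"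
      by (auto simp: edge_counts_def uniform_hypergraph_def)
    then show "m \<in> {..n choose k}"
      using card_mono[of "{e. e \<subseteq> V \<and> card e = k}" E] n_subsets[of V k] by auto
  qed
qed simp

lemma edge_counts_nonempty: "edge_counts (D :: 'd::finite itself) k n \<noteq> {}"
proof -
  have "inj_on (\<lambda>i. vec (real i) :: real ^ 'd) {..<n}"
    by (auto simp: inj_on_def vec_eq_iff)
  then have "uniform_hypergraph k {..<n} {} \<and> card {..<n} = n \<and>
      (\<exists>f :: nat \<Rightarrow> real ^ 'd. convex_embedding k {..<n} {} f)"
    by (auto simp: uniform_hypergraph_def convex_embedding_def convex_position_def)
  then show ?thesis
    unfolding edge_counts_def by blast
qed

text \<open>The condition \<open>d \<ge> 2k - 3\<close> is written without truncated subtraction.\<close>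

definition n_kd :: "nat \<Rightarrow> nat \<Rightarrow> nat" where
  "n_kd k d =
     (if d = 1 then (if k = 1 then 2 else k)
      else if d + 3 \<ge> 2 * k then d + 2
      else d div 2 + k)"

end

theory Submission
  imports Defs
begin

text \<open>Barycenters are in convex position iff each is exposed by a linear functional.  For
  \<open>d \<ge> 2k\<close> vertices on the moment curve work: the polynomial \<open>\<Prod>v\<in>e. (t - v)\<^sup>2\<close> exposes \<open>e\<close>.
  For the lower bounds the vertices are placed on the \<open>d\<close> parabolas \<open>(1 + x) e\<^sub>i + x\<^sup>2 u\<close>, where
  \<open>u\<close> is the all-ones vector; every set of fewer than \<open>d\<close> vertices from distinct parabolas is
  exposed among the sets of its size of this kind.  For the upper bound, an affine dependence
  whose negative coefficients lie in a \<open>k\<close>-set \<open>e\<close> and whose positive ones lie outside prevents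
  \<open>e\<close> from being exposed among all \<open>k\<close>-sets.  A balanced dependence on \<open>d + 3\<close> points then rules
  out the complete hypergraph on \<open>n_kd k d + 1\<close> vertices, and de Caen's bound on hypergraph Turan
  numbers gives the density.  The limit exists because the edge density is decreasing in \<open>n\<close>.\<close>

section \<open>Hyperedge counts and exposed points\<close>

lemma card_le_max_edges:
  fixes f :: "nat \<Rightarrow> real ^ 'd::finite"
  assumes "uniform_hypergraph k V E" "card V = n" "convex_embedding k V E f"
  shows "card E \<le> max_edges TYPE('d) k n"
  unfolding max_edges_def
  by (rule Max_ge[OF finite_edge_counts]) (use assms in \<open>auto simp: edge_counts_def\<close>)

lemma max_edges_attained:
  obtains V :: "nat set" and E and f :: "nat \<Rightarrow> real ^ 'd::finite"
  where "uniform_hypergraph k V E" "card V = n" "convex_embedding k V E f"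
    "card E = max_edges TYPE('d) k n"
proof -
  have "max_edges TYPE('d) k n \<in> edge_counts TYPE('d) k n"
    unfolding max_edges_def by (rule Max_in[OF finite_edge_counts edge_counts_nonempty])
  then obtain V :: "nat set" and E and f :: "nat \<Rightarrow> real ^ 'd"
    where "max_edges TYPE('d) k n = card E" "uniform_hypergraph k V E" "card V = n"
      "convex_embedding k V E f"
    unfolding edge_counts_def by blast
  then show thesis using that by metis
qed

lemma max_edges_le_choose: "max_edges TYPE('d::finite) k n \<le> n choose k"
proof -
  obtain V :: "nat set" and E and f :: "nat \<Rightarrow> real ^ 'd"
    where *: "uniform_hypergraph k V E" "card V = n" "card E = max_edges TYPE('d) k n"
    using max_edges_attained[where k=k and n=n and 'd='d] by metis
  then have "card E \<le> card {e. e \<subseteq> V \<and> card e = k}"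
    by (intro card_mono) (auto simp: uniform_hypergraph_def)
  with * show ?thesis
    by (simp add: n_subsets uniform_hypergraph_def)
qed

lemma convex_position_subset:
  assumes "convex_position p I" "J \<subseteq> I"
  shows "convex_position p J"
  unfolding convex_position_def
proof safe
  show "inj_on p J"
    using assms unfolding convex_position_def by (meson inj_on_subset)
next
  fix i assume i: "i \<in> J" "p i \<in> convex hull (p ` (J - {i}))"
  moreover have "convex hull (p ` (J - {i})) \<subseteq> convex hull (p ` (I - {i}))"
    using assms by (intro hull_mono) auto
  ultimately show False
    using assms unfolding convex_position_def by blast
qed

text \<open>The open half-space where \<open>c\<close> exceeds its value at \<open>p i\<close> is
  convex and contains the other points, hence also their hull.\<close>

lemma convex_position_if_exposed:
  fixes p :: "'i \<Rightarrow> 'a::real_inner"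
  assumes "\<And>i. i \<in> I \<Longrightarrow> \<exists>c. \<forall>j\<in>I - {i}. c \<bullet> p i < c \<bullet> p j"
  shows "convex_position p I"
  unfolding convex_position_def
proof safe
  show "inj_on p I"
  proof (rule inj_onI, rule ccontr)
    fix i j assume "i \<in> I" "j \<in> I" "p i = p j" "i \<noteq> j"
    then show False using assms[of i] by auto
  qed
next
  fix i assume i: "i \<in> I" "p i \<in> convex hull (p ` (I - {i}))"
  from assms[OF i(1)] obtain c where c: "\<forall>j\<in>I - {i}. c \<bullet> p i < c \<bullet> p j" by blast
  have "convex hull (p ` (I - {i})) \<subseteq> {y. c \<bullet> y > c \<bullet> p i}"
    by (rule hull_minimal) (use c in \<open>auto simp: convex_halfspace_gt\<close>)
  with i(2) show False by auto
qed

lemma inner_barycenter: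
  "c \<bullet> barycenter k f e = (\<Sum>v\<in>e. c \<bullet> f v) / real k"
  by (simp add: barycenter_def inner_sum_right)

text \<open>The criterion behind both constructions: sums over vertices replace barycenters, because
  the common factor \<open>1 / real k\<close> is positive.\<close>

lemma convex_embedding_if_exposed:
  fixes f :: "nat \<Rightarrow> 'a::real_inner"
  assumes "inj_on f V" "k \<ge> 1"
    and "\<And>e. e \<in> E \<Longrightarrow> \<exists>c. \<forall>e'\<in>E - {e}. (\<Sum>v\<in>e. c \<bullet> f v) < (\<Sum>v\<in>e'. c \<bullet> f v)"
  shows "convex_embedding k V E f"
  unfolding convex_embedding_def
proof (intro conjI convex_position_if_exposed)
  fix e assume "e \<in> E"
  then obtain c where "\<forall>e'\<in>E - {e}. (\<Sum>v\<in>e. c \<bullet> f v) < (\<Sum>v\<in>e'. c \<bullet> f v)"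
    using assms(3) by blast
  then show "\<exists>c. \<forall>e'\<in>E - {e}. c \<bullet> barycenter k f e < c \<bullet> barycenter k f e'"
    unfolding inner_barycenter using \<open>k \<ge> 1\<close> by (intro exI[of _ c]) (auto intro: divide_strict_right_mono)
qed (use assms in auto)

section \<open>Dimension at least \<open>2 * k\<close>: vertices on the moment curve\<close>

lemma max_edges_high_dim:
  assumes "k \<ge> 1" "CARD('d::finite) \<ge> 2 * k"
  shows "max_edges TYPE('d) k n = n choose k"
proof (rule antisym[OF max_edges_le_choose])
  obtain idx :: "'d \<Rightarrow> nat" where idx: "bij_betw idx UNIV {..<CARD('d)}"
    using finite_same_card_bij[of "UNIV :: 'd set" "{..<CARD('d)}"] by auto
  define f where "f v = (\<chi> i. real v ^ Suc (idx i) :: real ^ 'd)" for v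
  define E where "E = {e. e \<subseteq> {..<n} \<and> card e = k}"
  have "inj_on f {..<n}"
  proof (rule inj_onI)
    fix v w assume eq: "f v = f w"
    have "0 \<in> idx ` UNIV" using idx assms by (auto simp: bij_betw_def)
    then obtain i where "idx i = 0" by auto
    then show "v = w" using arg_cong[OF eq, of "\<lambda>y. y $ i"] by (simp add: f_def)
  qed
  moreover have "\<exists>c. \<forall>e'\<in>E - {e}. (\<Sum>v\<in>e. c \<bullet> f v) < (\<Sum>v\<in>e'. c \<bullet> f v)" if e: "e \<in> E" for e
  proof -
    \<comment> \<open>\<open>q\<close> is nonnegative, vanishes among the vertices exactly on
      \<open>e\<close>, and has degree at most \<open>2 * k\<close>. Its nonconstant coefficients
      form the functional \<open>c\<close>; the missing constant term contributes equally to all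
      \<open>k\<close>-sets.\<close>
    define q where "q = (\<Prod>v\<in>e. [:- real v, 1:]^2)"
    define c where "c = (\<chi> i. coeff q (Suc (idx i)) :: real ^ 'd)"
    have fin: "finite e" "card e = k" using e finite_subset unfolding E_def by auto
    have "degree q \<le> (\<Sum>v\<in>e. 2)"
      unfolding q_def by (rule order.trans[OF degree_prod_sum_le])
        (use fin in \<open>auto simp: degree_power_eq\<close>)
    then have deg: "degree q \<le> CARD('d)" using fin assms by simp
    have q: "poly q t = (\<Prod>v\<in>e. (t - real v)^2)" for t
      by (simp add: q_def poly_prod)
    have inner: "c \<bullet> f v = poly q (real v) - coeff q 0" for v
    proof -
      have "c \<bullet> f v = (\<Sum>i\<in>UNIV. coeff q (Suc (idx i)) * real v ^ Suc (idx i))"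
        by (simp add: inner_vec_def c_def f_def)
      also have "\<dots> = (\<Sum>j<CARD('d). coeff q (Suc j) * real v ^ Suc j)"
        using sum.reindex_bij_betw[OF idx, of "\<lambda>j. coeff q (Suc j) * real v ^ Suc j"] by simp
      also have "\<dots> = (\<Sum>j\<le>CARD('d). coeff q j * real v ^ j) - coeff q 0"
        by (simp add: sum.atMost_shift)
      also have "(\<Sum>j\<le>CARD('d). coeff q j * real v ^ j) = poly q (real v)"
        unfolding poly_altdef using deg
        by (intro sum.mono_neutral_right) (auto simp: coeff_eq_0)
      finally show ?thesis .
    qed
    have "(\<Sum>v\<in>e. c \<bullet> f v) < (\<Sum>v\<in>e'. c \<bullet> f v)" if e': "e' \<in> E - {e}" for e'
    proof -
      have fin': "finite e'" "card e' = k" using e' finite_subset unfolding E_def by auto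
      have "\<not> e' \<subseteq> e" using e' fin fin' card_subset_eq by blast
      then obtain w where w: "w \<in> e'" "w \<notin> e" by blast
      have "(\<Sum>v\<in>e. poly q (real v)) = 0"
        unfolding q using fin by (intro sum.neutral) (auto simp: prod_zero_iff)
      also have "0 < (\<Sum>v\<in>e'. poly q (real v))"
        unfolding q using w fin fin'
        by (intro sum_pos2[of _ w] prod_pos prod_nonneg) auto
      finally show ?thesis unfolding inner using fin fin' by (simp add: sum_subtractf)
    qed
    then show ?thesis by blast
  qed
  ultimately have "convex_embedding k {..<n} E f"
    using assms by (intro convex_embedding_if_exposed) auto
  then have "card E \<le> max_edges TYPE('d) k n"
    by (intro card_le_max_edges) (auto simp: uniform_hypergraph_def E_def)
  then show "n choose k \<le> max_edges TYPE('d) k n"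
    by (simp add: E_def n_subsets)
qed

section \<open>Transversal hypergraphs\<close>

lemma inner_parabola_point:
  fixes c :: "real ^ 'd::finite"
  shows "c \<bullet> ((1 + x) *\<^sub>R axis i 1 + x\<^sup>2 *\<^sub>R 1) = (1 + x) * c $ i + x\<^sup>2 * (\<Sum>j\<in>UNIV. c $ j)"
proof -
  have "c \<bullet> 1 = (\<Sum>j\<in>UNIV. c $ j)"
    by (simp add: inner_vec_def)
  then show ?thesis
    by (simp add: inner_add_right inner_axis)
qed

text \<open>If the coordinates of \<open>c\<close> sum to \<open>s\<close>, then \<open>c\<close>
  takes the value \<open>(1 + x) * c $ i + x^2 * s\<close> on parabola \<open>i\<close>. On a
  parabola met by \<open>e\<close>, the choice of \<open>c $ i\<close> puts the minimum at the
  vertex of \<open>e\<close>, with negative value \<open>m i\<close>; on all others the value is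
  positive. A competitor has at most one vertex per parabola, so it can at best collect the same
  minima.\<close>

lemma transversal_exposed:
  fixes p :: "nat \<Rightarrow> 'd::finite" and f :: "nat \<Rightarrow> real ^ 'd"
  assumes f: "\<And>v. f v = (1 + real (Suc v)) *\<^sub>R axis (p v) 1 + (real (Suc v))\<^sup>2 *\<^sub>R 1"
    and e: "finite e" "inj_on p e" "card e < CARD('d)"
  shows "\<exists>c. \<forall>e'. finite e' \<and> inj_on p e' \<and> card e' = card e \<and> e' \<noteq> e \<longrightarrow>
    (\<Sum>v\<in>e. c \<bullet> f v) < (\<Sum>v\<in>e'. c \<bullet> f v)"
proof -
  define I where "I = p ` e"
  define a where "a i = real (Suc (inv_into e p i))" for i
  \<comment> \<open>Solves the consistency condition that the coordinates of \<open>c\<close>, which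
    themselves depend on \<open>s\<close>, sum to \<open>s\<close>. It is positive because
    \<open>e\<close> misses some parabola.\<close>
  define s where "s = (real CARD('d) - real (card I)) / (1 + 2 * (\<Sum>i\<in>I. a i))"
  define c where "c = ((\<chi> i. if i \<in> I then - 2 * a i * s else 1) :: real ^ 'd)"
  define m where "m i = - s * (2 * a i + (a i)\<^sup>2)" for i
  define h where "h v = c \<bullet> f v" for v
  have a_pos: "a i > 0" for i by (simp add: a_def)
  have card_I: "card I = card e" unfolding I_def using e by (simp add: card_image)
  have denom: "1 + 2 * (\<Sum>i\<in>I. a i) > 0"
    using a_pos by (intro add_pos_nonneg mult_nonneg_nonneg sum_nonneg) (auto intro: less_imp_le)
  then have s_pos: "s > 0" unfolding s_def using e card_I by simp
  have sum_c: "(\<Sum>j\<in>UNIV. c $ j) = s"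
  proof -
    have "(\<Sum>j\<in>UNIV. c $ j) = (\<Sum>j\<in>I. c $ j) + (\<Sum>j\<in>-I. c $ j)"
      by (subst sum.union_disjoint[symmetric]) (auto simp: Compl_partition)
    also have "(\<Sum>j\<in>I. c $ j) = - 2 * s * (\<Sum>j\<in>I. a j)"
      by (simp add: c_def sum_distrib_left sum_distrib_right sum_negf mult_ac)
    also have "(\<Sum>j\<in>-I. c $ j) = real CARD('d) - real (card I)"
      by (simp add: c_def Compl_eq_Diff_UNIV card_Diff_subset of_nat_diff card_mono)
    also have "\<dots> = s * (1 + 2 * (\<Sum>i\<in>I. a i))"
      unfolding s_def using denom by simp
    finally show ?thesis by (simp add: algebra_simps)
  qed
  have h: "h v = (1 + real (Suc v)) * c $ p v + (real (Suc v))\<^sup>2 * s" for v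
    unfolding h_def f inner_parabola_point sum_c ..
  have h_in: "h v = m (p v) + s * (real (Suc v) - a (p v))\<^sup>2" if "p v \<in> I" for v
    unfolding h m_def using that by (simp add: c_def power2_eq_square algebra_simps)
  have h_out: "h v > 0" if "p v \<notin> I" for v
    unfolding h using that s_pos by (simp add: c_def add_pos_nonneg)
  have a_e: "a (p v) = real (Suc v)" if "v \<in> e" for v
    unfolding a_def using that e by simp
  have m_neg: "m i < 0" for i
    unfolding m_def using s_pos a_pos[of i] by (simp add: add_pos_pos)
  \<comment> \<open>A lower bound for \<open>h\<close> on parabola \<open>i\<close>, strict at every
    vertex outside \<open>e\<close>.\<close>
  define M where "M i = (if i \<in> I then m i else 0)" for i
  have h_ge: "M (p v) \<le> h v" for v
    unfolding M_def using h_in[of v] h_out[of v] s_pos by auto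
  have h_gt: "M (p v) < h v" if "v \<notin> e" for v
  proof (cases "p v \<in> I")
    case True
    then obtain w where w: "w \<in> e" "p v = p w" unfolding I_def by blast
    then have "v \<noteq> w" using that by blast
    then have "real (Suc v) - a (p v) \<noteq> 0" using a_e[of w] w by simp
    then show ?thesis using True h_in[of v] s_pos by (simp add: M_def)
  qed (use h_out[of v] in \<open>auto simp: M_def\<close>)
  have sum_e: "(\<Sum>v\<in>e. h v) = (\<Sum>i\<in>I. m i)"
  proof -
    have "(\<Sum>i\<in>I. m i) = (\<Sum>v\<in>e. m (p v))"
      unfolding I_def using sum.reindex[OF e(2), of m] by simp
    also have "\<dots> = (\<Sum>v\<in>e. h v)"
      using h_in a_e by (intro sum.cong) (auto simp: I_def)
    finally show ?thesis ..
  qed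
  have "(\<Sum>v\<in>e. h v) < (\<Sum>v\<in>e'. h v)"
    if e': "finite e'" "inj_on p e'" "card e' = card e" "e' \<noteq> e" for e'
  proof -
    have "\<not> e' \<subseteq> e" using e e' card_subset_eq by blast
    then obtain w where w: "w \<in> e'" "w \<notin> e" by blast
    \<comment> \<open>The minima that \<open>e'\<close> misses are negative, so leaving them out
      only increases the sum.\<close>
    have "(\<Sum>i\<in>I. m i) \<le> (\<Sum>i\<in>p ` e' \<inter> I. m i)"
      using m_neg by (intro sum_mono2[where f = "\<lambda>i. - m i", simplified sum_negf neg_le_iff_le])
        (auto intro: less_imp_le)
    also have "\<dots> = (\<Sum>i\<in>p ` e'. M i)"
      unfolding M_def using e' by (simp add: sum.inter_restrict)
    also have "\<dots> = (\<Sum>v\<in>e'. M (p v))"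
      using sum.reindex[OF e'(2), of M] by simp
    also have "\<dots> < (\<Sum>v\<in>e'. h v)"
      using h_ge h_gt w e' by (intro sum_strict_mono_ex1) auto
    finally show ?thesis unfolding sum_e .
  qed
  then show ?thesis unfolding h_def by blast
qed

text \<open>The last \<open>t\<close> vertices lie in every edge; the rest of an edge is one vertex
  from each of \<open>l\<close> parabolas. The padding reaches edge size \<open>k\<close> even when
  \<open>CARD('d) \<le> k\<close>, as \<open>transversal_exposed\<close> covers only sizes below
  \<open>CARD('d)\<close>.\<close>

lemma max_edges_ge_transversals:
  assumes k: "k = l + t" "k \<ge> 1" and l: "l < CARD('d::finite)" and t: "t \<le> n"
  shows "(CARD('d) choose l) * ((n - t) div CARD('d)) ^ l \<le> max_edges TYPE('d) k n"
proof -
  let ?d = "CARD('d)"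
  define m where "m = (n - t) div ?d"
  have d: "?d > 0" by simp
  obtain idx :: "'d \<Rightarrow> nat" where idx: "bij_betw idx UNIV {..<?d}"
    using finite_same_card_bij[of "UNIV :: 'd set" "{..<?d}"] by auto
  have idx_less: "idx i < ?d" for i
    using idx by (auto simp: bij_betw_def)
  have idx_inj: "inj idx"
    using idx by (auto simp: bij_betw_def)
  \<comment> \<open>The residue modulo \<open>?d\<close> names the parabola and the quotient the
    position on it, so the transversal part of an edge determines both \<open>I\<close> and
    \<open>g\<close>.\<close>
  define vtx where "vtx i j = j * ?d + idx i" for i j
  define p where "p v = inv idx (v mod ?d)" for v
  have p_vtx: "p (vtx i j) = i" for i j
    unfolding p_def vtx_def using idx_less idx_inj by simp
  have vtx_div: "vtx i j div ?d = j" for i j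
    unfolding vtx_def using idx_less d by simp
  have vtx_less: "vtx i j < n - t" if "j < m" for i j
  proof -
    have "vtx i j < (j + 1) * ?d" unfolding vtx_def using idx_less[of i] by simp
    also have "\<dots> \<le> m * ?d" using that by (intro mult_right_mono) auto
    also have "\<dots> \<le> n - t" unfolding m_def by simp
    finally show ?thesis .
  qed
  define S where "S = Sigma {I :: 'd set. card I = l} (\<lambda>I. PiE I (\<lambda>_. {..<m}))"
  define edge where "edge = (\<lambda>(I, g). (\<lambda>i. vtx i (g i)) ` I)"
  define F where "F = {n - t..<n}"
  define E where "E = (\<lambda>x. edge x \<union> F) ` S"
  have p_edge: "p ` edge (I, g) = I" for I g
    unfolding edge_def by (auto simp: p_vtx image_image)
  have inj_edge: "inj_on p (edge x)" for x
    unfolding edge_def by (cases x) (auto simp: inj_on_def p_vtx)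
  have card_edge: "card (edge x) = l" if "x \<in> S" for x
    using that card_image[OF inj_edge[of x]] p_edge by (cases x) (auto simp: S_def)
  have fin_edge: "finite (edge x)" for x
    unfolding edge_def by (cases x) auto
  have edge_less: "edge x \<subseteq> {..<n - t}" if "x \<in> S" for x
    using that by (cases x) (auto simp: S_def edge_def PiE_def Pi_def intro!: vtx_less)
  have disj: "edge x \<inter> F = {}" if "x \<in> S" for x
    using edge_less[OF that] by (auto simp: F_def)
  have "inj_on edge S"
  proof (rule inj_onI)
    fix x y assume x: "x \<in> S" and y: "y \<in> S" and eq: "edge x = edge y"
    obtain I g J h where xy: "x = (I, g)" "y = (J, h)" by (cases x, cases y) auto
    have IJ: "I = J" using p_edge[of I g] p_edge[of J h] eq xy by simp
    have "g i = h i" if "i \<in> I" for i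
    proof -
      have "vtx i (g i) \<in> edge y" using that eq[symmetric] by (auto simp: xy edge_def)
      then obtain j where "vtx i (g i) = vtx j (h j)" by (auto simp: xy edge_def)
      then show ?thesis using p_vtx vtx_div by metis
    qed
    then have "g = h" using x y IJ by (auto simp: S_def xy intro: PiE_ext)
    then show "x = y" using IJ xy by simp
  qed
  moreover have "inj_on (\<lambda>e. e \<union> F) (edge ` S)"
    using disj by (intro inj_onI) blast
  ultimately have "inj_on (\<lambda>x. edge x \<union> F) S"
    using comp_inj_on[of edge S "\<lambda>e. e \<union> F"] by (simp add: comp_def)
  then have "card E = card S" unfolding E_def by (rule card_image)
  also have "\<dots> = (\<Sum>I\<in>{I :: 'd set. card I = l}. card (PiE I (\<lambda>_. {..<m})))"
    unfolding S_def by (intro card_SigmaI) (auto intro!: finite_PiE)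
  also have "\<dots> = (\<Sum>I\<in>{I :: 'd set. card I = l}. m ^ l)"
    by (intro sum.cong) (auto simp: card_PiE)
  also have "\<dots> = (?d choose l) * m ^ l"
    using n_subsets[of "UNIV :: 'd set" l] by simp
  finally have card_E: "card E = (?d choose l) * m ^ l" .
  define f where "f v = (1 + real (Suc v)) *\<^sub>R axis (p v) 1 + (real (Suc v))\<^sup>2 *\<^sub>R (1 :: real ^ 'd)" for v
  have "inj f"
  proof (rule inj_onI)
    fix v w assume "f v = f w"
    \<comment> \<open>The all-ones functional has the value \<open>1 + x + x^2 * ?d\<close> on every
      parabola, which is strictly increasing in the vertex.\<close>
    then have "(1 :: real ^ 'd) \<bullet> f v = 1 \<bullet> f w" by simp
    then have eq: "1 + real (Suc v) + (real (Suc v))\<^sup>2 * ?d = 1 + real (Suc w) + (real (Suc w))\<^sup>2 * ?d"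
      unfolding f_def inner_parabola_point by simp
    have less: "1 + real (Suc v) + (real (Suc v))\<^sup>2 * ?d < 1 + real (Suc w) + (real (Suc w))\<^sup>2 * ?d"
      if "v < w" for v w
      using that by (intro add_less_le_mono[of "1 + real (Suc v)"] mult_right_mono power_mono) auto
    show "v = w" using eq less[of v w] less[of w v] by (cases v w rule: linorder_cases) auto
  qed
  have "convex_embedding k {..<n} E f"
  proof (rule convex_embedding_if_exposed)
    show "inj_on f {..<n}" using \<open>inj f\<close> by (rule inj_on_subset) simp
    fix e assume "e \<in> E"
    then obtain x where x: "x \<in> S" "e = edge x \<union> F" unfolding E_def by blast
    obtain c where c: "\<And>e'. finite e' \<Longrightarrow> inj_on p e' \<Longrightarrow> card e' = card (edge x) \<Longrightarrow> e' \<noteq> edge x \<Longrightarrow>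
        (\<Sum>v\<in>edge x. c \<bullet> f v) < (\<Sum>v\<in>e'. c \<bullet> f v)"
      using transversal_exposed[of f p "edge x", OF f_def fin_edge inj_edge] card_edge[OF x(1)] l
      by auto
    show "\<exists>c. \<forall>e'\<in>E - {e}. (\<Sum>v\<in>e. c \<bullet> f v) < (\<Sum>v\<in>e'. c \<bullet> f v)"
    proof (intro exI[of _ c] ballI)
      fix e' assume "e' \<in> E - {e}"
      then obtain y where y: "y \<in> S" "e' = edge y \<union> F" "edge y \<noteq> edge x"
        unfolding E_def using x by auto
      have "(\<Sum>v\<in>edge x. c \<bullet> f v) < (\<Sum>v\<in>edge y. c \<bullet> f v)"
        using x y by (intro c fin_edge inj_edge) (auto simp: card_edge)
      \<comment> \<open>\<open>F\<close> adds the same amount to both sides.\<close>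
      then show "(\<Sum>v\<in>e. c \<bullet> f v) < (\<Sum>v\<in>e'. c \<bullet> f v)"
        unfolding x(2) y(2) using disj x(1) y(1) fin_edge
        by (simp add: sum.union_disjoint F_def)
    qed
  qed (use k in auto)
  moreover have "uniform_hypergraph k {..<n} E"
    unfolding uniform_hypergraph_def
  proof safe
    fix e assume "e \<in> E"
    then obtain x where x: "x \<in> S" "e = edge x \<union> F" unfolding E_def by blast
    show "card e = k"
      unfolding x(2) using card_Un_disjoint[of "edge x" F] fin_edge[of x] disj[OF x(1)] card_edge[OF x(1)] t k
      by (simp add: F_def)
    fix v assume "v \<in> e"
    then show "v < n" using \<open>v \<in> e\<close> edge_less[OF x(1)] unfolding x(2) F_def by auto
  qed
  ultimately have "card E \<le> max_edges TYPE('d) k n"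
    by (intro card_le_max_edges) auto
  then show ?thesis unfolding card_E m_def .
qed

section \<open>Complete hypergraphs without convex embedding\<close>

lemma affine_dependence_exists:
  fixes f :: "'v \<Rightarrow> 'a::euclidean_space"
  assumes "finite S" "inj_on f S" "card S \<ge> DIM('a) + 2"
  obtains u where "\<And>v. v \<notin> S \<Longrightarrow> u v = 0" "\<exists>v\<in>S. u v \<noteq> (0::real)"
    "(\<Sum>v\<in>S. u v) = 0" "(\<Sum>v\<in>S. u v *\<^sub>R f v) = 0"
proof -
  have "affine_dependent (f ` S)"
    using assms by (intro affine_dependent_biggerset) (auto simp: card_image)
  then obtain U where U: "sum U (f ` S) = 0" "\<exists>v\<in>f ` S. U v \<noteq> 0" "(\<Sum>v\<in>f ` S. U v *\<^sub>R v) = 0"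
    using affine_dependent_explicit_finite[of "f ` S"] assms(1) by auto
  show ?thesis
    using U by (intro that[of "\<lambda>v. if v \<in> S then U (f v) else 0"])
      (auto simp: sum.reindex[OF assms(2)])
qed

section \<open>Combinations of two vectors with balanced signs\<close>

lemma card_pos_add_card_neg_le:
  assumes "finite S"
  shows "card {v\<in>S. (z v :: real) > 0} + card {v\<in>S. z v < 0} \<le> card S"
  by (subst card_Un_disjoint[symmetric]) (use assms in \<open>auto intro: card_mono\<close>)

text \<open>Strict signs are open conditions, and finitely many of them persist together near
  \<open>r\<close>.\<close>

lemma eventually_signs_affine:
  fixes x y :: "'v \<Rightarrow> real"
  assumes "finite S"
  shows "\<forall>\<^sub>F \<mu> in nhds r. \<forall>v\<in>S. (y v + r * x v > 0 \<longrightarrow> y v + \<mu> * x v > 0) \<and>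
    (y v + r * x v < 0 \<longrightarrow> y v + \<mu> * x v < 0)"
proof (intro eventually_ball_finite assms ballI eventually_conj)
  fix v assume "v \<in> S"
  have lim: "((\<lambda>\<mu>. y v + \<mu> * x v) \<longlongrightarrow> y v + r * x v) (nhds r)"
    by (intro tendsto_add tendsto_mult tendsto_const filterlim_ident)
  show "\<forall>\<^sub>F \<mu> in nhds r. y v + r * x v > 0 \<longrightarrow> y v + \<mu> * x v > 0"
    using order_tendstoD(1)[OF lim, of 0] by (cases "y v + r * x v > 0") auto
  show "\<forall>\<^sub>F \<mu> in nhds r. y v + r * x v < 0 \<longrightarrow> y v + \<mu> * x v < 0"
    using order_tendstoD(2)[OF lim, of 0] by (cases "y v + r * x v < 0") auto
qed

lemma large_multiple_dominates:
  fixes x y :: "'v \<Rightarrow> real"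
  assumes "finite S"
  obtains r where "\<And>v. v \<in> S \<Longrightarrow> x v > 0 \<Longrightarrow> y v + r * x v > 0"
proof -
  \<comment> \<open>The sum dominates each single threshold \<open>\<bar>y v\<bar> / x v + 1\<close>
    and is also defined when \<open>x\<close> has no positive entry.\<close>
  define r where "r = (\<Sum>v\<in>S. if x v > 0 then \<bar>y v\<bar> / x v + 1 else 0)"
  have "y v + r * x v > 0" if "v \<in> S" "x v > 0" for v
  proof -
    have "(if x v > 0 then \<bar>y v\<bar> / x v + 1 else 0) \<le> r"
      unfolding r_def using assms that
      by (intro member_le_sum[of v S "\<lambda>v. if x v > 0 then \<bar>y v\<bar> / x v + 1 else 0"]) auto
    then have "(\<bar>y v\<bar> / x v + 1) * x v \<le> r * x v"
      using that by (intro mult_right_mono) auto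
    moreover have "(\<bar>y v\<bar> / x v + 1) * x v = \<bar>y v\<bar> + x v"
      using that by (simp add: distrib_right)
    ultimately show ?thesis using that by linarith
  qed
  then show ?thesis by (rule that)
qed

text \<open>Between parameters with and without a positive majority lies a frontier point
  \<open>r\<close>. Strict signs at \<open>r\<close> persist nearby, so neighbours without a
  positive majority rule one out at \<open>r\<close>, and neighbours with one rule out a negative
  majority. Some entry must vanish at \<open>r\<close>, or no majority could change there.\<close>

lemma balanced_combination_if_mostly_positive:
  fixes x y :: "'v \<Rightarrow> real"
  assumes S: "finite S" and t: "t \<in> S" "x t \<noteq> 0" "y t = 0" and y: "\<exists>v\<in>S. y v \<noteq> 0"
    and x: "2 * card {v\<in>S. x v > 0} > card S"
  shows "\<exists>r. (\<exists>v\<in>S. y v + r * x v \<noteq> 0) \<and> (\<exists>v\<in>S. y v + r * x v = 0) \<and>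
    2 * card {v\<in>S. y v + r * x v > 0} \<le> card S \<and>
    2 * card {v\<in>S. y v + r * x v < 0} \<le> card S"
proof -
  define P where "P r = {v\<in>S. y v + r * x v > 0}" for r
  define N where "N r = {v\<in>S. y v + r * x v < 0}" for r
  define A where "A = {r. 2 * card (P r) > card S}"
  have PN: "card (P r) + card (N r) \<le> card S" for r
    unfolding P_def N_def using card_pos_add_card_neg_le[OF S] .
  have fin: "finite (P r)" "finite (N r)" for r unfolding P_def N_def using S by auto
  obtain l where l: "\<And>v. v \<in> S \<Longrightarrow> x v > 0 \<Longrightarrow> y v + l * x v > 0"
    using large_multiple_dominates[OF S] by blast
  then have "{v\<in>S. x v > 0} \<subseteq> P l" unfolding P_def by blast
  from card_mono[OF fin(1) this] have "card {v\<in>S. x v > 0} \<le> card (P l)" .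
  then have "l \<in> A" unfolding A_def using x by simp
  \<comment> \<open>Domination applied to \<open>- y\<close> makes the corresponding entries of
    \<open>y - l' * x\<close> negative.\<close>
  obtain l' where l': "\<And>v. v \<in> S \<Longrightarrow> x v > 0 \<Longrightarrow> - y v + l' * x v > 0"
    using large_multiple_dominates[OF S, of x "\<lambda>v. - y v"] by blast
  have "{v\<in>S. x v > 0} \<subseteq> N (- l')"
  proof
    fix v assume "v \<in> {v\<in>S. x v > 0}"
    then show "v \<in> N (- l')" using l'[of v] by (simp add: N_def)
  qed
  from card_mono[OF fin(2) this] have "card {v\<in>S. x v > 0} \<le> card (N (- l'))" .
  then have "- l' \<notin> A" unfolding A_def using x PN[of "- l'"] by simp
  \<comment> \<open>\<open>A\<close> is neither empty nor the whole line, so connectedness gives it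
    a frontier point.\<close>
  with \<open>l \<in> A\<close> obtain r where r: "r \<in> frontier A"
    using frontier_eq_empty[of A] by blast
  have signs: "\<forall>\<^sub>F \<mu> in nhds r. P r \<subseteq> P \<mu> \<and> N r \<subseteq> N \<mu>"
    using eventually_signs_affine[OF S, of y r x] by eventually_elim (auto simp: P_def N_def)
  then obtain U where U: "open U" "r \<in> U" "\<And>\<mu>. \<mu> \<in> U \<Longrightarrow> P r \<subseteq> P \<mu> \<and> N r \<subseteq> N \<mu>"
    unfolding eventually_nhds by blast
  obtain \<mu> where \<mu>: "\<mu> \<in> U" "\<mu> \<in> A"
    using r U closure_iff_nhds_not_empty[of r A] unfolding frontier_def by blast
  obtain \<mu>' where \<mu>': "\<mu>' \<in> U" "\<mu>' \<notin> A"
    using r U interior_maximal[of U A] unfolding frontier_def by blast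
  have P_le: "2 * card (P r) \<le> card S"
    using \<mu>' U(3)[of \<mu>'] card_mono[OF fin(1), of "P r" \<mu>'] by (simp add: A_def)
  have N_less: "2 * card (N r) < card S"
    using \<mu> U(3)[of \<mu>] card_mono[OF fin(2), of "N r" \<mu>] PN[of \<mu>] by (simp add: A_def)
  have "\<exists>v\<in>S. y v + r * x v = 0"
  proof (rule ccontr)
    assume "\<not> ?thesis"
    then have "P r \<union> N r = S" by (force simp: P_def N_def)
    then have "P \<mu> \<subseteq> P r" using U(3)[OF \<mu>(1)] by (auto simp: P_def N_def)
    then have "card (P \<mu>) \<le> card (P r)" by (rule card_mono[OF fin(1)])
    then show False using P_le \<mu>(2) unfolding A_def by simp
  qed
  \<comment> \<open>For \<open>r \<noteq> 0\<close> the entry at \<open>t\<close> survives because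
    \<open>y t = 0\<close>; for \<open>r = 0\<close> the vector is \<open>y\<close> itself.\<close>
  moreover have "\<exists>v\<in>S. y v + r * x v \<noteq> 0"
  proof (cases "r = 0")
    case False
    then show ?thesis using x t by (intro bexI[of _ t]) auto
  qed (use y in auto)
  ultimately show ?thesis
    using P_le less_imp_le[OF N_less] unfolding P_def N_def
    by (intro exI[of _ r]) simp
qed

text \<open>If \<open>x\<close> is balanced it serves itself, vanishing at \<open>s\<close>.
  Otherwise \<open>x\<close> or \<open>- x\<close> has a positive majority and the search along a
  line through \<open>y\<close> applies.\<close>

lemma balanced_combination:
  fixes x y :: "'v \<Rightarrow> real"
  assumes S: "finite S" and s: "s \<in> S" "x s = 0" and t: "t \<in> S" "x t \<noteq> 0" "y t = 0"
    and y: "\<exists>v\<in>S. y v \<noteq> 0"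
  shows "\<exists>\<alpha> \<beta>. (\<exists>v\<in>S. \<alpha> * y v + \<beta> * x v \<noteq> 0) \<and> (\<exists>v\<in>S. \<alpha> * y v + \<beta> * x v = 0) \<and>
    2 * card {v\<in>S. \<alpha> * y v + \<beta> * x v > 0} \<le> card S \<and>
    2 * card {v\<in>S. \<alpha> * y v + \<beta> * x v < 0} \<le> card S"
proof -
  consider "2 * card {v\<in>S. x v > 0} > card S" | "2 * card {v\<in>S. x v < 0} > card S"
    | "2 * card {v\<in>S. x v > 0} \<le> card S" "2 * card {v\<in>S. x v < 0} \<le> card S"
    by linarith
  then show ?thesis
  proof cases
    case 1
    from balanced_combination_if_mostly_positive[where x = x, OF S t y 1] obtain r where
      "(\<exists>v\<in>S. y v + r * x v \<noteq> 0) \<and> (\<exists>v\<in>S. y v + r * x v = 0) \<and>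
       2 * card {v\<in>S. y v + r * x v > 0} \<le> card S \<and> 2 * card {v\<in>S. y v + r * x v < 0} \<le> card S" ..
    then show ?thesis by - (rule exI[of _ 1], rule exI[of _ r], simp)
  next
    case 2
    then have "2 * card {v\<in>S. - x v > 0} > card S" by simp
    from balanced_combination_if_mostly_positive[where x = "\<lambda>v. - x v", OF S t(1) _ t(3) y this] t(2)
    obtain r where
      "(\<exists>v\<in>S. y v + r * - x v \<noteq> 0) \<and> (\<exists>v\<in>S. y v + r * - x v = 0) \<and>
       2 * card {v\<in>S. y v + r * - x v > 0} \<le> card S \<and> 2 * card {v\<in>S. y v + r * - x v < 0} \<le> card S"
      by auto
    then show ?thesis by - (rule exI[of _ 1], rule exI[of _ "- r"], simp)
  next
    case 3
    then show ?thesis using s t by - (rule exI[of _ 0], rule exI[of _ 1], auto)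
  qed
qed

text \<open>Among \<open>d + 3\<close> points the affine dependences have dimension at least two; a balanced
  one with a vanishing coefficient improves on the Radon partition of \<open>d + 2\<close> points.\<close>

lemma balanced_affine_dependence:
  fixes f :: "'v \<Rightarrow> 'a::euclidean_space"
  assumes S: "finite S" "inj_on f S" "card S = DIM('a) + 3"
  obtains z :: "'v \<Rightarrow> real" where "\<exists>v\<in>S. z v \<noteq> 0" "(\<Sum>v\<in>S. z v) = 0" "(\<Sum>v\<in>S. z v *\<^sub>R f v) = 0"
    "card {v\<in>S. z v < 0} \<le> (DIM('a) + 2) div 2" "card {v\<in>S. z v > 0} \<le> (DIM('a) + 3) div 2"
proof -
  obtain s where s: "s \<in> S" using S by fastforce
  \<comment> \<open>Without \<open>s\<close> there are still \<open>DIM('a) + 2\<close> points,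
    hence a dependence; it is read on \<open>S\<close> with coefficient zero at
    \<open>s\<close>.\<close>
  have drop: "\<exists>u. u s = (0::real) \<and> (\<exists>v\<in>S. u v \<noteq> 0) \<and> (\<Sum>v\<in>S. u v) = 0 \<and> (\<Sum>v\<in>S. u v *\<^sub>R f v) = 0"
    if s: "s \<in> S" for s
  proof -
    have "inj_on f (S - {s})" using S by (meson inj_on_subset Diff_subset)
    then obtain u where "\<And>v. v \<notin> S - {s} \<Longrightarrow> u v = 0" "\<exists>v\<in>S - {s}. u v \<noteq> (0::real)"
      "(\<Sum>v\<in>S - {s}. u v) = 0" "(\<Sum>v\<in>S - {s}. u v *\<^sub>R f v) = 0"
      using affine_dependence_exists[of "S - {s}" f] S s by auto
    then show ?thesis using S s by (intro exI[of _ u]) (auto simp: sum.remove)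
  qed
  obtain x where x: "x s = (0::real)" "\<exists>v\<in>S. x v \<noteq> 0" "(\<Sum>v\<in>S. x v) = 0" "(\<Sum>v\<in>S. x v *\<^sub>R f v) = 0"
    using drop[OF s] by blast
  \<comment> \<open>Dropping a point where \<open>x\<close> is nonzero makes the second dependence
    \<open>y\<close> independent of \<open>x\<close>.\<close>
  then obtain t where t: "t \<in> S" "x t \<noteq> 0" by blast
  obtain y where y: "y t = (0::real)" "\<exists>v\<in>S. y v \<noteq> 0" "(\<Sum>v\<in>S. y v) = 0" "(\<Sum>v\<in>S. y v *\<^sub>R f v) = 0"
    using drop[OF t(1)] by blast
  obtain \<alpha> \<beta> where ab: "\<exists>v\<in>S. \<alpha> * y v + \<beta> * x v \<noteq> 0" "\<exists>v\<in>S. \<alpha> * y v + \<beta> * x v = 0"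
    "2 * card {v\<in>S. \<alpha> * y v + \<beta> * x v > 0} \<le> card S"
    "2 * card {v\<in>S. \<alpha> * y v + \<beta> * x v < 0} \<le> card S"
    using balanced_combination[OF S(1) s x(1) t y(1,2)] by blast
  define z where "z v = \<alpha> * y v + \<beta> * x v" for v
  obtain w where w: "w \<in> S" "z w = 0" using ab by (auto simp: z_def)
  \<comment> \<open>The zero at \<open>w\<close> leaves at most \<open>DIM('a) + 2\<close> nonzero
    coefficients, so the rarer sign occurs at most \<open>(DIM('a) + 2) div 2\<close> times;
    replacing \<open>z\<close> by \<open>- z\<close> if necessary makes it the negative one.\<close>
  have "card {v\<in>S. z v > 0} + card {v\<in>S. z v < 0} \<le> card (S - {w})"
  proof -
    have "{v\<in>S. z v > 0} = {v\<in>S - {w}. z v > 0}" "{v\<in>S. z v < 0} = {v\<in>S - {w}. z v < 0}"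
      using w by auto
    then show ?thesis using card_pos_add_card_neg_le[of "S - {w}" z] S by simp
  qed
  then have total: "card {v\<in>S. z v > 0} + card {v\<in>S. z v < 0} \<le> DIM('a) + 2"
    using S w by simp
  have nz: "\<exists>v\<in>S. z v \<noteq> 0" using ab by (simp add: z_def)
  have sum0: "(\<Sum>v\<in>S. z v) = 0" "(\<Sum>v\<in>S. z v *\<^sub>R f v) = 0"
    using x y unfolding z_def
    by (simp_all add: sum.distrib scaleR_left_distrib flip: sum_distrib_left scaleR_scaleR scaleR_sum_right)
  have half: "2 * card {v\<in>S. z v > 0} \<le> DIM('a) + 3" "2 * card {v\<in>S. z v < 0} \<le> DIM('a) + 3"
    using ab S unfolding z_def by simp_all
  show ?thesis
  proof (cases "card {v\<in>S. z v < 0} \<le> card {v\<in>S. z v > 0}")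
    case True
    show ?thesis by (rule that[of z]) (use True nz sum0 half total in auto)
  next
    case False
    show ?thesis by (rule that[of "\<lambda>v. - z v"]) (use False nz sum0 half total in \<open>auto simp: sum_negf\<close>)
  qed
qed

section \<open>Affine dependences that obstruct exposing an edge\<close>

lemma exposed_if_convex_position:
  fixes p :: "'i \<Rightarrow> 'a::euclidean_space"
  assumes "finite I" "convex_position p I" "i \<in> I"
  obtains c where "\<And>j. j \<in> I \<Longrightarrow> j \<noteq> i \<Longrightarrow> c \<bullet> p i < c \<bullet> p j"
proof -
  let ?H = "convex hull (p ` (I - {i}))"
  have "closed ?H"
    using assms by (intro compact_imp_closed compact_convex_hull finite_imp_compact) auto
  moreover have "p i \<notin> ?H" using assms unfolding convex_position_def by blast
  ultimately obtain c b where c: "c \<bullet> p i < b" "\<And>x. x \<in> ?H \<Longrightarrow> c \<bullet> x > b"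
    using separating_hyperplane_closed_point[of ?H "p i"] by auto
  show ?thesis
  proof (rule that[of c])
    fix j assume "j \<in> I" "j \<noteq> i"
    then have "p j \<in> ?H" by (intro hull_inc) auto
    then show "c \<bullet> p i < c \<bullet> p j" using c by fastforce
  qed
qed

text \<open>An exposing functional of a hyperedge \<open>e\<close> is, by exchanging single vertices, larger on every
  vertex outside \<open>e\<close> than on every vertex of \<open>e\<close>; so no affine dependence separates the two.\<close>

lemma no_dependence_across_edge:
  fixes f :: "'v \<Rightarrow> 'a::euclidean_space" and z :: "'v \<Rightarrow> real"
  assumes V: "finite V" and emb: "convex_embedding k V {e. e \<subseteq> V \<and> card e = k} f"
    and z: "(\<Sum>v\<in>V. z v) = 0" "(\<Sum>v\<in>V. z v *\<^sub>R f v) = 0"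
    and e: "e \<subseteq> V" "card e = k" "k \<ge> 1" "\<And>v. v \<in> e \<Longrightarrow> z v \<le> 0" "\<And>v. v \<in> V - e \<Longrightarrow> z v \<ge> 0"
  shows "\<forall>v\<in>V - e. z v = 0"
proof -
  let ?E = "{e. e \<subseteq> V \<and> card e = k}"
  have fin_e: "finite e" "e \<noteq> {}" using e V finite_subset by auto
  obtain c where c: "\<And>e'. e' \<in> ?E \<Longrightarrow> e' \<noteq> e \<Longrightarrow> c \<bullet> barycenter k f e < c \<bullet> barycenter k f e'"
    using exposed_if_convex_position[of ?E "barycenter k f" e] emb e V
    unfolding convex_embedding_def by auto
  have less: "c \<bullet> f a < c \<bullet> f b" if ab: "a \<in> e" "b \<in> V - e" for a b
  proof -
    let ?e' = "insert b (e - {a})"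
    have "?e' \<in> ?E" using ab e fin_e by (auto simp: card_insert_if card_Diff_singleton)
    moreover have "?e' \<noteq> e" using ab by blast
    ultimately have "c \<bullet> barycenter k f e < c \<bullet> barycenter k f ?e'" by (rule c)
    then have "(\<Sum>v\<in>e. c \<bullet> f v) < (\<Sum>v\<in>?e'. c \<bullet> f v)"
      unfolding inner_barycenter using e by (simp add: divide_less_cancel)
    also have "\<dots> = c \<bullet> f b + (\<Sum>v\<in>e - {a}. c \<bullet> f v)"
      using ab fin_e by simp
    finally show ?thesis using ab fin_e by (simp add: sum.remove)
  qed
  \<comment> \<open>A level that separates \<open>e\<close> from the other vertices. As the
    coefficients sum to zero, subtracting \<open>h\<close> keeps the weighted sum at zero while
    making every term nonnegative.\<close>
  define h where "h = Max ((\<lambda>v. c \<bullet> f v) ` e)"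
  have h_ge: "c \<bullet> f v \<le> h" if "v \<in> e" for v
    unfolding h_def using that fin_e by (intro Max_ge) auto
  have h_less: "h < c \<bullet> f v" if "v \<in> V - e" for v
    unfolding h_def using that fin_e less by simp
  have "(\<Sum>v\<in>V. z v * (c \<bullet> f v - h)) = c \<bullet> (\<Sum>v\<in>V. z v *\<^sub>R f v) - (\<Sum>v\<in>V. z v) * h"
    by (simp add: inner_sum_right right_diff_distrib sum_subtractf sum_distrib_right)
  also have "\<dots> = 0" using z by simp
  finally have 0: "(\<Sum>v\<in>V. z v * (c \<bullet> f v - h)) = 0" .
  have "z v * (c \<bullet> f v - h) \<ge> 0" if "v \<in> V" for v
  proof (cases "v \<in> e")
    case True
    then show ?thesis using e(4) h_ge by (simp add: mult_nonpos_nonpos)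
  next
    case False
    then show ?thesis using e(5)[of v] h_less[of v] that by simp
  qed
  then have "\<forall>v\<in>V. z v * (c \<bullet> f v - h) = 0"
    using 0 V by (simp add: sum_nonneg_eq_0_iff)
  then show ?thesis using h_less by fastforce
qed

lemma obtain_subset_between:
  assumes "finite V" "A \<subseteq> V" "B \<subseteq> V" "A \<inter> B = {}" "card A \<le> k" "card B + k \<le> card V"
  obtains e where "A \<subseteq> e" "e \<subseteq> V - B" "card e = k"
proof -
  have "finite B" using assms finite_subset by blast
  then have "k \<le> card (V - B)" using assms by (simp add: card_Diff_subset)
  then show ?thesis
    using exists_subset_between[of A k "V - B"] assms that by blast
qed

text \<open>The two cardinality bounds leave room for a \<open>k\<close>-set \<open>e\<close>
  containing all negative coefficients and no positive one. Then \<open>z\<close> vanishes outside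
  \<open>e\<close>, so it is nonpositive with sum zero.\<close>

lemma no_balanced_dependence:
  fixes f :: "'v \<Rightarrow> 'a::euclidean_space" and z :: "'v \<Rightarrow> real"
  assumes V: "finite V" and emb: "convex_embedding k V {e. e \<subseteq> V \<and> card e = k} f" and k: "k \<ge> 1"
    and z: "(\<Sum>v\<in>V. z v) = 0" "(\<Sum>v\<in>V. z v *\<^sub>R f v) = 0"
    and neg: "card {v\<in>V. z v < 0} \<le> k" and pos: "card {v\<in>V. z v > 0} + k \<le> card V"
  shows "\<forall>v\<in>V. z v = 0"
proof -
  obtain e where e: "{v\<in>V. z v < 0} \<subseteq> e" "e \<subseteq> V - {v\<in>V. z v > 0}" "card e = k"
  proof -
    have "{v\<in>V. z v < 0} \<inter> {v\<in>V. z v > 0} = {}" by auto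
    from obtain_subset_between[OF V _ _ this neg pos] show ?thesis
      using that by (metis (no_types, lifting) mem_Collect_eq subsetI)
  qed
  have out: "\<forall>v\<in>V - e. z v = 0"
    using e k by (intro no_dependence_across_edge[OF V emb z]) force+
  have nonpos: "z v \<le> 0" if "v \<in> V" for v
    using out e that by (cases "v \<in> e") auto
  have "(\<Sum>v\<in>V. - z v) = 0" using z by (simp add: sum_negf)
  then show ?thesis using nonpos V by (subst (asm) sum_nonneg_eq_0_iff) auto
qed

text \<open>There are at least \<open>DIM('a) + 3\<close> vertices, so a balanced dependence on that
  many of them, extended by zero, contradicts \<open>no_balanced_dependence\<close>.\<close>

lemma no_convex_embedding_complete:
  fixes f :: "'v \<Rightarrow> 'a::euclidean_space"
  assumes k: "k \<ge> 1" and d: "DIM('a) \<noteq> 1" "DIM('a) \<le> 2 * k - 1" "k + 1 \<le> DIM('a)"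
    and V: "finite V" "card V = n_kd k DIM('a) + 1"
  shows "\<not> convex_embedding k V {e. e \<subseteq> V \<and> card e = k} f"
proof
  let ?d = "DIM('a)"
  assume emb: "convex_embedding k V {e. e \<subseteq> V \<and> card e = k} f"
  have "?d + 3 \<le> card V" using d V unfolding n_kd_def by (auto split: if_splits)
  then obtain S where S: "S \<subseteq> V" "card S = ?d + 3" "finite S"
    by (meson obtain_subset_with_card_n)
  have "inj_on f S" using emb S unfolding convex_embedding_def by (meson inj_on_subset)
  then obtain z where z: "\<exists>v\<in>S. z v \<noteq> (0::real)" "(\<Sum>v\<in>S. z v) = 0" "(\<Sum>v\<in>S. z v *\<^sub>R f v) = 0"
    "card {v\<in>S. z v < 0} \<le> (?d + 2) div 2" "card {v\<in>S. z v > 0} \<le> (?d + 3) div 2"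
    using balanced_affine_dependence[OF S(3) \<open>inj_on f S\<close> S(2)] by blast
  define w where "w v = (if v \<in> S then z v else 0)" for v
  have sets: "{v\<in>V. w v < 0} = {v\<in>S. z v < 0}" "{v\<in>V. w v > 0} = {v\<in>S. z v > 0}"
    unfolding w_def using S by auto
  have sums: "(\<Sum>v\<in>V. w v) = 0" "(\<Sum>v\<in>V. w v *\<^sub>R f v) = 0"
    using z S V sum.mono_neutral_cong_right[OF V(1) S(1), of w z]
      sum.mono_neutral_cong_right[OF V(1) S(1), of "\<lambda>v. w v *\<^sub>R f v" "\<lambda>v. z v *\<^sub>R f v"]
    by (simp_all add: w_def)
  have nz: "\<exists>v\<in>V. w v \<noteq> 0" using z S by (auto simp: w_def)
  \<comment> \<open>For \<open>2 * k \<le> ?d + 3\<close> the negative part fits into an edge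
    because \<open>?d \<le> 2 * k - 1\<close>. For larger \<open>k\<close> the roles of the signs
    swap: the positive part fits, and the \<open>?d div 2 + 1\<close> possible negative coefficients
    together with \<open>k\<close> exactly fill the \<open>?d div 2 + k + 1\<close>
    vertices.\<close>
  consider "card {v\<in>V. w v < 0} \<le> k" "card {v\<in>V. w v > 0} + k \<le> card V"
    | "card {v\<in>V. w v > 0} \<le> k" "card {v\<in>V. w v < 0} + k \<le> card V"
  proof (cases "2 * k \<le> ?d + 3")
    case True
    then have "card V = ?d + 3" using d V by (simp add: n_kd_def)
    with True d z(4,5)[folded sets] show ?thesis by (intro that(1)) linarith+
  next
    case False
    then have "card V = ?d div 2 + k + 1" using d V by (simp add: n_kd_def)
    with False z(4,5)[folded sets] show ?thesis by (intro that(2)) linarith+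
  qed
  then show False
  proof cases
    case 1
    then show False using no_balanced_dependence[OF V(1) emb k sums] nz by blast
  next
    case 2
    then have "\<forall>v\<in>V. - w v = 0"
      using sums by (intro no_balanced_dependence[OF V(1) emb k]) (simp_all add: sum_negf)
    then show False using nz by simp
  qed
qed

section \<open>De Caen's bound\<close>

text \<open>For finite \<open>V\<close> and \<open>s < k\<close> every \<open>s\<close>-subset of
  \<open>V\<close> is a clique, which lets the induction on the size start at
  \<open>k - 1\<close>.\<close>

definition cliques :: "nat \<Rightarrow> 'v set \<Rightarrow> 'v set set \<Rightarrow> nat \<Rightarrow> 'v set set" where
  "cliques k V E s = {T. T \<subseteq> V \<and> card T = s \<and> (\<forall>e. e \<subseteq> T \<and> card e = k \<longrightarrow> e \<in> E)}"

definition extensions :: "nat \<Rightarrow> 'v set \<Rightarrow> 'v set set \<Rightarrow> nat \<Rightarrow> 'v set \<Rightarrow> 'v set" where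
  "extensions k V E s U = {y \<in> V - U. insert y U \<in> cliques k V E (Suc s)}"

lemma finite_cliques: "finite V \<Longrightarrow> finite (cliques k V E s)"
  unfolding cliques_def by (rule finite_subset[of _ "Pow V"]) auto

lemma cliqueD:
  assumes "T \<in> cliques k V E s"
  shows "T \<subseteq> V" "card T = s" "\<And>e. e \<subseteq> T \<Longrightarrow> card e = k \<Longrightarrow> e \<in> E"
  using assms unfolding cliques_def by auto

lemma clique_remove:
  assumes "T \<in> cliques k V E (Suc s)" "x \<in> T"
  shows "T - {x} \<in> cliques k V E s"
proof -
  have "finite T" using cliqueD(2)[OF assms(1)] card.infinite by fastforce
  then show ?thesis using assms by (auto simp: cliques_def)
qed

lemma cliques_below:
  assumes "finite V" "Suc s = k"
  shows "cliques k V E s = {T. T \<subseteq> V \<and> card T = s}"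
proof -
  have "card e \<noteq> k" if "T \<subseteq> V" "card T = s" "e \<subseteq> T" for T e
  proof -
    have "card e \<le> card T" using that assms(1) by (intro card_mono) (auto intro: finite_subset)
    then show ?thesis using that(2) assms(2) by simp
  qed
  then show ?thesis unfolding cliques_def by blast
qed

lemma cliques_uniform:
  assumes "uniform_hypergraph k V E"
  shows "cliques k V E k = E"
proof -
  have "e = T" if "T \<subseteq> V" "card T = k" "e \<subseteq> T" "card e = k" for T e
    using that assms card_subset_eq finite_subset unfolding uniform_hypergraph_def by metis
  then show ?thesis using assms unfolding cliques_def uniform_hypergraph_def by blast
qed

text \<open>Adding \<open>y\<close> to \<open>U\<close> turns pairs of a clique and an extending
  vertex into pairs of a larger clique and one of its elements; deleting \<open>y\<close> inverts
  this.\<close>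

lemma sum_card_extensions:
  assumes "finite V"
  shows "(\<Sum>U\<in>cliques k V E s. card (extensions k V E s U)) = Suc s * card (cliques k V E (Suc s))"
proof -
  let ?C = "cliques k V E"
  define A where "A = Sigma (?C s) (extensions k V E s)"
  define B where "B = Sigma (?C (Suc s)) (\<lambda>T. T)"
  have fin: "finite T" if "T \<in> ?C j" for T j
    using cliqueD(1)[OF that] assms finite_subset by blast
  have "bij_betw (\<lambda>(U, y). (insert y U, y)) A B"
  proof (rule bij_betw_byWitness[where f' = "\<lambda>(T, y). (T - {y}, y)"])
    show "\<forall>z\<in>A. (\<lambda>(T, y). (T - {y}, y)) ((\<lambda>(U, y). (insert y U, y)) z) = z"
      by (auto simp: A_def extensions_def)
    show "\<forall>z\<in>B. (\<lambda>(U, y). (insert y U, y)) ((\<lambda>(T, y). (T - {y}, y)) z) = z"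
      by (auto simp: B_def)
    show "(\<lambda>(U, y). (insert y U, y)) ` A \<subseteq> B"
      by (auto simp: A_def B_def extensions_def)
    show "(\<lambda>(T, y). (T - {y}, y)) ` B \<subseteq> A"
    proof safe
      fix T y assume "(T, y) \<in> B"
      then have T: "T \<in> ?C (Suc s)" "y \<in> T" unfolding B_def by auto
      then show "(T - {y}, y) \<in> A"
        using clique_remove[OF T] cliqueD(1)[OF T(1)]
        by (auto simp: A_def extensions_def insert_absorb)
    qed
  qed
  then have "card A = card B" by (rule bij_betw_same_card)
  moreover have "card A = (\<Sum>U\<in>?C s. card (extensions k V E s U))"
    unfolding A_def using assms by (intro card_SigmaI finite_cliques ballI) (auto simp: extensions_def)
  moreover have "card B = (\<Sum>T\<in>?C (Suc s). card T)"
    unfolding B_def using assms fin by (intro card_SigmaI finite_cliques ballI) auto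
  moreover have "(\<Sum>T\<in>?C (Suc s). card T) = (\<Sum>T\<in>?C (Suc s). Suc s)"
    by (intro sum.cong) (auto simp: cliqueD(2))
  ultimately show ?thesis by simp
qed

text \<open>Both sides count triples of a clique \<open>U\<close> of size \<open>s\<close>, a vertex \<open>x\<close> completing \<open>U\<close> to a
  clique and a vertex \<open>y\<close> not completing it; equivalently pairs of a clique and a non-clique
  of size \<open>s + 1\<close> meeting in \<open>s\<close> vertices.  A clique \<open>S\<close> of size \<open>s + 1\<close> that \<open>y\<close> does not
  extend lies with \<open>y\<close> over a missing \<open>k\<close>-set \<open>D\<close>, and every \<open>x \<in> S - D\<close> gives such a triple.\<close>

lemma clique_pair_count:
  fixes V :: "'v set" and E :: "'v set set"
  assumes V: "finite V" and k: "k \<ge> 1" "k \<le> Suc s"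
  defines "C \<equiv> cliques k V E" and "X \<equiv> extensions k V E"
  shows "(s + 2 - k) * (\<Sum>S\<in>C (Suc s). card (V - S - X (Suc s) S))
    \<le> (\<Sum>U\<in>C s. card (X s U) * card (V - U - X s U))"
proof -
  define Q where "Q = Sigma (C s) (\<lambda>U. X s U \<times> (V - U - X s U))"
  define R where "R = Sigma (C (Suc s)) (\<lambda>S. Sigma (V - S - X (Suc s) S) (\<lambda>y. {x\<in>S. y \<notin> X s (S - {x})}))"
  have fin_X: "finite (X j U)" for j U unfolding X_def extensions_def using V by auto
  have fin: "finite T" if "T \<in> C j" for T j
    using cliqueD(1)[OF that[unfolded C_def]] V finite_subset by blast
  have fin_C: "finite (C j)" for j unfolding C_def by (rule finite_cliques[OF V])
  have many: "s + 2 - k \<le> card {x\<in>S. y \<notin> X s (S - {x})}"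
    if S: "S \<in> C (Suc s)" and y: "y \<in> V - S - X (Suc s) S" for S y
  proof -
    have S': "S \<subseteq> V" "card S = Suc s" "finite S" using cliqueD[OF S[unfolded C_def]] fin[OF S] by auto
    have "insert y S \<notin> C (Suc (Suc s))" using y by (auto simp: X_def extensions_def C_def)
    \<comment> \<open>A missing \<open>k\<close>-set in \<open>insert y S\<close> must contain
      \<open>y\<close>, since \<open>S\<close> is a clique. For \<open>x\<close> in \<open>S\<close>
      outside \<open>D\<close>, the set \<open>D\<close> survives in
      \<open>insert y (S - {x})\<close>, so \<open>y\<close> does not extend \<open>S - {x}\<close>;
      there are \<open>s + 2 - k\<close> such \<open>x\<close>.\<close>
    then obtain D where D: "D \<subseteq> insert y S" "card D = k" "D \<notin> E"
      unfolding C_def cliques_def using S' y by auto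
    have "y \<in> D"
    proof (rule ccontr)
      assume "y \<notin> D"
      then have "D \<subseteq> S" using D by blast
      then show False using cliqueD(3)[OF S[unfolded C_def], of D] D by blast
    qed
    have "finite D" using D S' by (meson finite_insert finite_subset)
    then have "card (D - {y}) = k - 1" using D \<open>y \<in> D\<close> by simp
    moreover have "D - {y} \<subseteq> S" using D by blast
    ultimately have "card (S - (D - {y})) = Suc s - (k - 1)"
      using card_Diff_subset[of "D - {y}" S] S' \<open>finite D\<close> by simp
    moreover have "S - (D - {y}) \<subseteq> {x\<in>S. y \<notin> X s (S - {x})}"
    proof
      fix x assume x: "x \<in> S - (D - {y})"
      have "y \<notin> X s (S - {x})"
      proof
        assume yx: "y \<in> X s (S - {x})"
        have "D \<subseteq> insert y (S - {x})" using D x y by blast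
        moreover have "insert y (S - {x}) \<in> cliques k V E (Suc s)"
          using yx by (simp add: X_def extensions_def)
        ultimately show False using cliqueD(3) D by blast
      qed
      then show "x \<in> {x\<in>S. y \<notin> X s (S - {x})}" using x by simp
    qed
    ultimately show ?thesis using card_mono[of "{x\<in>S. y \<notin> X s (S - {x})}" "S - (D - {y})"] S' k by simp
  qed
  have "(s + 2 - k) * (\<Sum>S\<in>C (Suc s). card (V - S - X (Suc s) S))
      = (\<Sum>S\<in>C (Suc s). \<Sum>y\<in>V - S - X (Suc s) S. s + 2 - k)"
    by (simp add: sum_distrib_left mult.commute)
  also have "\<dots> \<le> (\<Sum>S\<in>C (Suc s). \<Sum>y\<in>V - S - X (Suc s) S. card {x\<in>S. y \<notin> X s (S - {x})})"
    by (intro sum_mono many)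
  also have "\<dots> = card R"
    unfolding R_def using V fin by (simp add: card_SigmaI fin_C)
  also have "\<dots> \<le> card Q"
  proof (rule card_inj_on_le)
    \<comment> \<open>The clique \<open>S\<close> is recovered by reinserting
      \<open>x\<close>.\<close>
    show "inj_on (\<lambda>(S, y, x). (S - {x}, x, y)) R"
      by (rule inj_on_inverseI[where g = "\<lambda>(U, x, y). (insert x U, y, x)"])
        (auto simp: R_def insert_absorb)
    show "(\<lambda>(S, y, x). (S - {x}, x, y)) ` R \<subseteq> Q"
    proof safe
      fix S y x assume "(S, y, x) \<in> R"
      then have *: "S \<in> C (Suc s)" "y \<in> V" "y \<notin> S" "x \<in> S" "y \<notin> X s (S - {x})" unfolding R_def by auto
      have "S - {x} \<in> C s" using clique_remove[of S k V E s x] *(1,4) by (simp add: C_def)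
      moreover have "x \<in> X s (S - {x})"
      proof -
        have "x \<in> V" using cliqueD(1)[of S k V E "Suc s"] *(1,4) unfolding C_def by blast
        moreover have "insert x (S - {x}) = S" using *(4) by blast
        ultimately show ?thesis using *(1) by (simp add: X_def extensions_def C_def)
      qed
      moreover have "y \<in> V - (S - {x}) - X s (S - {x})" using *(2,3,5) by blast
      ultimately show "(S - {x}, x, y) \<in> Q" unfolding Q_def by (intro SigmaI)
    qed
    show "finite Q" unfolding Q_def using V fin_C fin_X by auto
  qed
  also have "\<dots> = (\<Sum>U\<in>C s. card (X s U) * card (V - U - X s U))"
    unfolding Q_def using V fin_C fin_X by (simp add: card_SigmaI card_cartesian_product)
  finally show ?thesis .
qed


lemma clique_nonempty_below:
  assumes "cliques k V E (Suc s) \<noteq> {}"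
  shows "cliques k V E s \<noteq> {}"
proof -
  obtain T where T: "T \<in> cliques k V E (Suc s)" using assms by blast
  then have "T \<noteq> {}" using cliqueD(2) by fastforce
  then show ?thesis using clique_remove[OF T] by blast
qed

text \<open>The quantity followed from size \<open>k - 1\<close>, where it measures the non-edges,
  up to the last size that has cliques, where no vertex extends anything.\<close>

definition avg_nonext :: "nat \<Rightarrow> 'v set \<Rightarrow> 'v set set \<Rightarrow> nat \<Rightarrow> real" where
  "avg_nonext k V E s =
     (\<Sum>U\<in>cliques k V E s. real (card (V - U - extensions k V E s U))) / card (cliques k V E s)"

lemma card_extensions_add:
  assumes "finite V" "U \<in> cliques k V E s"
  shows "real (card (extensions k V E s U)) + real (card (V - U - extensions k V E s U))
    = real (card V) - real s"
proof -
  have "extensions k V E s U \<subseteq> V - U" by (auto simp: extensions_def)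
  moreover have U: "U \<subseteq> V" "card U = s" "finite U"
    using cliqueD[OF assms(2)] assms(1) finite_subset by auto
  ultimately have "card (V - U) = card (extensions k V E s U) + card (V - U - extensions k V E s U)"
    using assms(1) by (subst card_Un_disjoint[symmetric]) (auto intro: finite_subset arg_cong[of _ _ card])
  moreover have "card (V - U) = card V - s" "s \<le> card V"
    using U assms(1) card_mono by (auto simp: card_Diff_subset)
  ultimately show ?thesis by (simp flip: of_nat_add)
qed

text \<open>For a clique of size \<open>s\<close>, the numbers \<open>x\<close> of extending and
  \<open>y\<close> of non-extending vertices have constant sum \<open>M\<close>. By Cauchy-Schwarz
  the mean of \<open>x * y\<close> is then at most the product of the means. Inserting this into
  \<open>clique_pair_count\<close>, with the sum of \<open>x\<close> given by
  \<open>sum_card_extensions\<close>, yields the bound.\<close>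

lemma avg_nonext_Suc:
  assumes V: "finite V" and k: "k \<ge> 1" "k \<le> Suc s" and ne: "cliques k V E (Suc s) \<noteq> {}"
  shows "real (s + 2 - k) * avg_nonext k V E (Suc s) \<le> real (Suc s) * avg_nonext k V E s"
proof -
  let ?C = "cliques k V E"
  define x where "x U = real (card (extensions k V E s U))" for U
  define y where "y U = real (card (V - U - extensions k V E s U))" for U
  define M where "M = real (card V) - real s"
  have pos: "real (card (?C s)) > 0" "real (card (?C (Suc s))) > 0"
    using ne clique_nonempty_below[OF ne] finite_cliques[OF V] by (simp_all add: card_gt_0_iff)
  have y_eq: "y U = M - x U" if "U \<in> ?C s" for U
    using card_extensions_add[OF V that] by (simp add: x_def y_def M_def)
  have sum_x: "(\<Sum>U\<in>?C s. x U) = real (Suc s) * real (card (?C (Suc s)))"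
    unfolding x_def using sum_card_extensions[OF V, of k E s] by (metis of_nat_mult of_nat_sum)
  have sum_y: "(\<Sum>U\<in>?C s. y U) = real (card (?C s)) * M - (\<Sum>U\<in>?C s. x U)"
    by (simp add: y_eq sum_subtractf)
  have "real (s + 2 - k) * (avg_nonext k V E (Suc s) * card (?C (Suc s))) \<le> (\<Sum>U\<in>?C s. x U * y U)"
  proof -
    have "real ((s + 2 - k) * (\<Sum>S\<in>?C (Suc s). card (V - S - extensions k V E (Suc s) S)))
      \<le> real (\<Sum>U\<in>?C s. card (extensions k V E s U) * card (V - U - extensions k V E s U))"
      using clique_pair_count[OF V k, of E] by (intro of_nat_mono)
    then show ?thesis using pos by (simp add: avg_nonext_def x_def y_def)
  qed
  also have "(\<Sum>U\<in>?C s. x U * y U) = M * (\<Sum>U\<in>?C s. x U) - (\<Sum>U\<in>?C s. (x U)\<^sup>2)"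
    by (simp add: y_eq sum_distrib_left power2_eq_square algebra_simps sum_subtractf)
  also have "\<dots> \<le> (\<Sum>U\<in>?C s. x U) * (\<Sum>U\<in>?C s. y U) / card (?C s)"
  proof -
    have "(\<Sum>U\<in>?C s. x U)\<^sup>2 \<le> (\<Sum>U\<in>?C s. (x U)\<^sup>2) * card (?C s)"
      by (rule sum_squared_le_sum_of_squares)
    then have "(\<Sum>U\<in>?C s. x U)\<^sup>2 / card (?C s) \<le> (\<Sum>U\<in>?C s. (x U)\<^sup>2)"
      using pos by (simp add: divide_le_eq)
    moreover have "(\<Sum>U\<in>?C s. x U) * (\<Sum>U\<in>?C s. y U) / card (?C s)
      = M * (\<Sum>U\<in>?C s. x U) - (\<Sum>U\<in>?C s. x U)\<^sup>2 / card (?C s)"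
      unfolding sum_y using pos by (simp add: field_simps power2_eq_square)
    ultimately show ?thesis by linarith
  qed
  also have "\<dots> = real (Suc s) * avg_nonext k V E s * card (?C (Suc s))"
    unfolding sum_x by (simp add: avg_nonext_def y_def)
  finally show ?thesis
    using pos(2) by (simp add: mult.assoc[symmetric] mult_le_cancel_right)
qed

text \<open>The factors \<open>(j + 1) / (j + 2 - k)\<close> from the single steps multiply to the
  binomial coefficient.\<close>

lemma avg_nonext_le:
  assumes V: "finite V" and k: "k \<ge> 1" and s: "k - 1 \<le> s" and ne: "cliques k V E s \<noteq> {}"
  shows "avg_nonext k V E s \<le> real (s choose (k - 1)) * avg_nonext k V E (k - 1)"
  using s ne
proof (induction s rule: dec_induct)
  case (step s)
  have sk: "k \<le> Suc s" using step by simp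
  have pos: "real (s + 2 - k) > 0" using sk by simp
  have "real (s + 2 - k) * avg_nonext k V E (Suc s) \<le> real (Suc s) * avg_nonext k V E s"
    using avg_nonext_Suc[OF V k sk step.prems] .
  also have "\<dots> \<le> real (Suc s) * (real (s choose (k - 1)) * avg_nonext k V E (k - 1))"
    using step.IH clique_nonempty_below[OF step.prems] by (intro mult_left_mono) auto
  also have "\<dots> = real (Suc s * (s choose (k - 1))) * avg_nonext k V E (k - 1)"
    by (simp only: of_nat_mult mult.assoc)
  also have "Suc s * (s choose (k - 1)) = (s + 2 - k) * (Suc s choose (k - 1))"
    using binomial_absorb_comp[of "Suc s" "k - 1"] k sk by (simp add: Suc_diff_le)
  finally show ?case using pos by (simp add: mult.assoc)
qed simp

text \<open>At the last size \<open>s < r\<close> with a clique, all \<open>n - s\<close> remaining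
  vertices fail to extend it, where \<open>n = card V\<close>. Comparing this average with the one
  at size \<open>k - 1\<close> forces many non-edges.\<close>

theorem de_Caen:
  fixes E :: "'v set set"
  assumes E: "uniform_hypergraph k V E" and k: "k \<ge> 1" "k \<le> r" and n: "k \<le> card V"
    and free: "cliques k V E r = {}"
  shows "real (card E) \<le> real (card V choose k) *
    (1 - (real (card V) + 1 - real r) / ((real (card V) + 1 - real k) * real ((r - 1) choose (k - 1))))"
proof -
  let ?C = "cliques k V E" and ?n = "card V"
  define b where "b = avg_nonext k V E (k - 1)"
  define B where "B = real ((r - 1) choose (k - 1))"
  have V: "finite V" using E by (simp add: uniform_hypergraph_def)
  have C0: "?C (k - 1) = {T. T \<subseteq> V \<and> card T = k - 1}"
    using cliques_below[OF V, of "k - 1" k E] k by simp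
  have card_C0: "card (?C (k - 1)) = ?n choose (k - 1)"
    unfolding C0 using n_subsets[OF V] by simp
  have C0_pos: "?n choose (k - 1) > 0" using n by simp
  \<comment> \<open>Cliques exist at size \<open>k - 1\<close> and not at size \<open>r\<close>, so
    they stop existing at some size in between.\<close>
  have "\<exists>s. k - 1 \<le> s \<and> s < r \<and> ?C s \<noteq> {} \<and> ?C (Suc s) = {}"
  proof (rule ccontr)
    assume no: "\<not> ?thesis"
    have "k - 1 \<le> r" using k by simp
    then have "?C r \<noteq> {}"
    proof (induction r rule: dec_induct)
      case base
      then show ?case using card_C0 C0_pos by fastforce
    next
      case (step m)
      then show ?case using no by blast
    qed
    then show False using free by simp
  qed
  then obtain s where s: "k - 1 \<le> s" "s < r" "?C s \<noteq> {}" "?C (Suc s) = {}" by blast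
  have b0: "b \<ge> 0" unfolding b_def avg_nonext_def by (simp add: sum_nonneg)
  have "extensions k V E s U = {}" for U using s by (simp add: extensions_def)
  then have "real (card (V - U - extensions k V E s U)) = real ?n - real s" if "U \<in> ?C s" for U
    using card_extensions_add[OF V that] by simp
  then have "avg_nonext k V E s = real ?n - real s"
    unfolding avg_nonext_def using s finite_cliques[OF V] by (simp add: card_gt_0_iff)
  then have "real ?n + 1 - real r \<le> avg_nonext k V E s" using s by simp
  also have "\<dots> \<le> real (s choose (k - 1)) * b"
    unfolding b_def by (rule avg_nonext_le[OF V k(1) s(1,3)])
  also have "\<dots> \<le> B * b"
    unfolding B_def using s b0 by (intro mult_right_mono of_nat_mono binomial_right_mono) auto
  finally have main: "real ?n + 1 - real r \<le> B * b" .
  \<comment> \<open>At size \<open>k - 1\<close> the extensions of a set are counted by edges, each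
    edge \<open>k\<close> times; this expresses \<open>b\<close> through
    \<open>card E\<close>.\<close>
  have "(\<Sum>U\<in>?C (k - 1). real (card (V - U - extensions k V E (k - 1) U)))
    = (\<Sum>U\<in>?C (k - 1). (real ?n + 1 - real k) - real (card (extensions k V E (k - 1) U)))"
  proof (intro sum.cong refl)
    fix U assume "U \<in> ?C (k - 1)"
    from card_extensions_add[OF V this] show "real (card (V - U - extensions k V E (k - 1) U))
        = (real ?n + 1 - real k) - real (card (extensions k V E (k - 1) U))"
      using k by (simp add: of_nat_diff)
  qed
  also have "\<dots> = real (?n choose (k - 1)) * (real ?n + 1 - real k)
      - real (\<Sum>U\<in>?C (k - 1). card (extensions k V E (k - 1) U))"
    by (simp add: sum_subtractf card_C0[unfolded One_nat_def])
  also have "(\<Sum>U\<in>?C (k - 1). card (extensions k V E (k - 1) U)) = k * card E"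
    using sum_card_extensions[OF V, of k E "k - 1"] k cliques_uniform[OF E] by simp
  finally have "b * real (?n choose (k - 1)) = real (?n choose (k - 1)) * (real ?n + 1 - real k) - real k * real (card E)"
    unfolding b_def avg_nonext_def using C0_pos by (simp add: card_C0[unfolded One_nat_def])
  moreover have "real k * real (?n choose k) = (real ?n + 1 - real k) * real (?n choose (k - 1))"
  proof -
    have "k * (?n choose k) = (?n - (k - 1)) * (?n choose (k - 1))"
      using binomial_absorption[of "k - 1" "?n"] binomial_absorb_comp[of "?n" "k - 1"] k by simp
    then have "real k * real (?n choose k) = real (?n - (k - 1)) * real (?n choose (k - 1))"
      by (simp flip: of_nat_mult)
    moreover have "real (?n - (k - 1)) = real ?n + 1 - real k" using k n by (simp add: of_nat_diff)
    ultimately show ?thesis by simp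
  qed
  ultimately have "real k * real (card E) = real k * real (?n choose k) - b * real (?n choose (k - 1))"
    by (simp add: mult.commute)
  moreover have B_pos: "B > 0" unfolding B_def using k by simp
  moreover have N_pos: "real ?n + 1 - real k > 0" using n by simp
  moreover have "real (?n choose (k - 1)) = real k * real (?n choose k) / (real ?n + 1 - real k)"
    using \<open>real k * real (?n choose k) = _\<close> N_pos by simp
  ultimately have "real k * real (card E) = real k * (real (?n choose k) * (1 - b / (real ?n + 1 - real k)))"
    by (simp add: algebra_simps)
  then have "real (card E) = real (?n choose k) * (1 - b / (real ?n + 1 - real k))"
    using k by simp
  also have "\<dots> \<le> real (?n choose k) * (1 - (real ?n + 1 - real r) / ((real ?n + 1 - real k) * B))"
  proof (intro mult_left_mono diff_left_mono)
    have "(real ?n + 1 - real r) / ((real ?n + 1 - real k) * B) \<le> B * b / ((real ?n + 1 - real k) * B)"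
      using main B_pos N_pos by (intro divide_right_mono) auto
    also have "\<dots> = b / (real ?n + 1 - real k)" using B_pos by simp
    finally show "(real ?n + 1 - real r) / ((real ?n + 1 - real k) * B) \<le> b / (real ?n + 1 - real k)" .
  qed simp
  finally show ?thesis unfolding B_def .
qed

section \<open>Asymptotic density\<close>

lemma convex_embedding_subset:
  assumes "convex_embedding k V E f" "V' \<subseteq> V" "E' \<subseteq> E"
  shows "convex_embedding k V' E' f"
  using assms(1) inj_on_subset[OF _ assms(2)] convex_position_subset[OF _ assms(3)]
  unfolding convex_embedding_def by blast

text \<open>Averaging over vertex deletions: every edge survives the deletion of exactly
  \<open>Suc n - k\<close> vertices, and each deletion leaves an embedded hypergraph on
  \<open>n\<close> vertices.\<close>

lemma max_edges_Suc:
  "(Suc n - k) * max_edges TYPE('d::finite) k (Suc n) \<le> Suc n * max_edges TYPE('d) k n"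
proof -
  obtain V :: "nat set" and E and f :: "nat \<Rightarrow> real ^ 'd"
    where V: "uniform_hypergraph k V E" "card V = Suc n" "convex_embedding k V E f"
      and E: "card E = max_edges TYPE('d) k (Suc n)"
    by (rule max_edges_attained[where k=k and n="Suc n" and 'd='d])
  have fin: "finite V" "finite E" "\<And>e. e \<in> E \<Longrightarrow> finite e"
    using V finite_subset[of E "Pow V"] finite_subset[of _ V] unfolding uniform_hypergraph_def by auto
  have "(Suc n - k) * card E = (\<Sum>e\<in>E. card {v\<in>V. v \<notin> e})"
  proof -
    have "card {v\<in>V. v \<notin> e} = Suc n - k" if "e \<in> E" for e
      using V fin that card_Diff_subset[of e V] unfolding uniform_hypergraph_def set_diff_eq by auto
    then show ?thesis by simp
  qed
  also have "\<dots> = (\<Sum>v\<in>V. card {e\<in>E. v \<notin> e})"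
    using sum.swap_restrict[OF fin(2,1), of "\<lambda>_ _. 1::nat" "\<lambda>e v. v \<notin> e"] by simp
  also have "\<dots> \<le> (\<Sum>v\<in>V. max_edges TYPE('d) k n)"
  proof (intro sum_mono card_le_max_edges)
    fix v assume v: "v \<in> V"
    show "uniform_hypergraph k (V - {v}) {e\<in>E. v \<notin> e}"
      using V by (auto simp: uniform_hypergraph_def)
    show "card (V - {v}) = n" using V v fin by simp
    show "convex_embedding k (V - {v}) {e\<in>E. v \<notin> e} f"
      by (rule convex_embedding_subset[OF V(3)]) auto
  qed
  finally show ?thesis using E V by simp
qed

text \<open>The deletion inequality divided by
  \<open>(Suc n - k) * (Suc n choose k) = Suc n * (n choose k)\<close>. Shifting the index by
  \<open>k\<close> keeps the denominators positive.\<close>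

lemma max_edges_density_decseq:
  "decseq (\<lambda>n. real (max_edges TYPE('d::finite) k (n + k)) / real ((n + k) choose k))"
proof (rule decseq_SucI)
  fix j
  define n where "n = j + k"
  define m where "m i = real (max_edges TYPE('d) k i)" for i
  have pos: "real (n choose k) > 0" "real (Suc n choose k) > 0" "real (Suc n - k) > 0"
    by (simp_all add: n_def)
  have "real (Suc n - k) * m (Suc n) \<le> real (Suc n) * m n"
    unfolding m_def using max_edges_Suc[of n k, where 'd='d] by (metis of_nat_mult of_nat_mono)
  moreover have "real (Suc n - k) * real (Suc n choose k) = real (Suc n) * real (n choose k)"
    using binomial_absorb_comp[of "Suc n" k] by (metis diff_Suc_1 of_nat_mult)
  ultimately have "(real (Suc n - k) * m (Suc n)) / (real (Suc n - k) * real (Suc n choose k))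
      \<le> (real (Suc n) * m n) / (real (Suc n) * real (n choose k))"
    using pos by (metis divide_right_mono of_nat_0_le_iff of_nat_mult)
  then have "m (Suc n) / real (Suc n choose k) \<le> m n / real (n choose k)"
    using pos by (simp del: of_nat_Suc)
  then show "real (max_edges TYPE('d) k (Suc j + k)) / real ((Suc j + k) choose k)
      \<le> real (max_edges TYPE('d) k (j + k)) / real ((j + k) choose k)"
    by (simp add: m_def n_def)
qed

lemma choose_over_power_tendsto:
  "(\<lambda>n. real (n choose k) / real n ^ k) \<longlonglongrightarrow> 1 / fact k"
proof -
  have "(\<lambda>n. (\<Prod>i=0..<k. (real n - real i) / real n) / fact k) \<longlonglongrightarrow> (\<Prod>i=0..<k. 1) / fact k"
  proof (intro tendsto_divide tendsto_prod tendsto_const)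
    fix i
    have "(\<lambda>n. 1 - real i / real n) \<longlonglongrightarrow> 1 - 0"
      by (intro tendsto_diff tendsto_const lim_const_over_n)
    then have "(\<lambda>n. 1 - real i / real n) \<longlonglongrightarrow> 1" by simp
    then show "(\<lambda>n. (real n - real i) / real n) \<longlonglongrightarrow> 1"
      by (rule Lim_transform_eventually)
        (use eventually_gt_at_top[of 0] in eventually_elim, auto simp: field_simps)
  qed simp
  moreover have "(\<Prod>i=0..<k. (real n - real i) / real n) / fact k = real (n choose k) / real n ^ k" for n
    by (simp add: binomial_gbinomial gbinomial_prod_rev prod_dividef)
  ultimately show ?thesis by simp
qed

lemma max_edges_density_convergent:
  obtains \<gamma> where "(\<lambda>n. real (max_edges TYPE('d::finite) k n) / real n ^ k) \<longlonglongrightarrow> \<gamma>"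
proof -
  let ?m = "\<lambda>n. real (max_edges TYPE('d) k n)"
  obtain L where "(\<lambda>n. ?m (n + k) / real ((n + k) choose k)) \<longlonglongrightarrow> L"
    using decseq_convergent[OF max_edges_density_decseq[of k, where 'd='d], of 0] by auto
  then have "(\<lambda>n. ?m n / real (n choose k)) \<longlonglongrightarrow> L" by (rule LIMSEQ_offset)
  then have "(\<lambda>n. ?m n / real (n choose k) * (real (n choose k) / real n ^ k)) \<longlonglongrightarrow> L * (1 / fact k)"
    by (intro tendsto_mult choose_over_power_tendsto)
  then have "(\<lambda>n. ?m n / real n ^ k) \<longlonglongrightarrow> L * (1 / fact k)"
    by (rule Lim_transform_eventually)
      (use eventually_ge_at_top[of k] in eventually_elim, auto)
  then show ?thesis by (rule that)
qed

section \<open>Bounds for the limiting density\<close>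

lemma density_ge:
  assumes lim: "(\<lambda>n. real (max_edges TYPE('d::finite) k n) / real n ^ k) \<longlonglongrightarrow> \<gamma>"
    and k: "k \<ge> 1" "k < CARD('d)"
  shows "real (CARD('d) choose k) * (1 / real CARD('d) ^ k) \<le> \<gamma>"
proof -
  let ?d = "CARD('d)"
  \<comment> \<open>Along multiples of \<open>?d\<close> the division in the transversal count is
    exact; as the limit exists, this subsequence determines it.\<close>
  have "filterlim (\<lambda>q. ?d * q) sequentially sequentially"
    by (intro filterlim_subseq strict_monoI) simp
  from filterlim_compose[OF lim this]
  have "(\<lambda>q. real (max_edges TYPE('d) k (?d * q)) / real (?d * q) ^ k) \<longlonglongrightarrow> \<gamma>" .
  moreover have "real (?d choose k) * (1 / real ?d ^ k) \<le> real (max_edges TYPE('d) k (?d * q)) / real (?d * q) ^ k"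
    if "q \<ge> 1" for q
  proof -
    have "(?d choose k) * ((?d * q - 0) div ?d) ^ k \<le> max_edges TYPE('d) k (?d * q)"
      using k by (intro max_edges_ge_transversals) auto
    then have "(?d choose k) * q ^ k \<le> max_edges TYPE('d) k (?d * q)" by simp
    then have "real (?d choose k) * real q ^ k \<le> real (max_edges TYPE('d) k (?d * q))"
      by (metis of_nat_mono of_nat_mult of_nat_power)
    then have "real (?d choose k) * real q ^ k / real (?d * q) ^ k
        \<le> real (max_edges TYPE('d) k (?d * q)) / real (?d * q) ^ k"
      by (intro divide_right_mono) auto
    then show ?thesis using that by (simp add: power_mult_distrib)
  qed
  ultimately show ?thesis by (intro LIMSEQ_le_const) auto
qed

text \<open>A clique on \<open>n_kd k CARD('d) + 1\<close> vertices would inherit a convex embedding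
  of the complete hypergraph, so de Caen's bound applies with this \<open>r\<close>. Its quotient
  \<open>(n + 1 - r) / (n + 1 - k)\<close> tends to 1.\<close>

lemma density_le:
  assumes lim: "(\<lambda>n. real (max_edges TYPE('d::finite) k n) / real n ^ k) \<longlonglongrightarrow> \<gamma>"
    and k: "k + 1 \<le> CARD('d)" "CARD('d) \<le> 2 * k - 1"
  shows "\<gamma> \<le> 1 / fact k * (1 - 1 / real (n_kd k CARD('d) choose (k - 1)))"
proof -
  define r where "r = n_kd k CARD('d) + 1"
  define B where "B = real (n_kd k CARD('d) choose (k - 1))"
  have k1: "k \<ge> 1" using k by simp
  have d1: "CARD('d) \<noteq> 1" using k by simp
  have kr: "k \<le> r" unfolding r_def n_kd_def using k by auto
  have "real (max_edges TYPE('d) k n) / real n ^ k \<le> real (n choose k) / real n ^ k *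
      (1 - (1 + real n - real r) / (1 + real n - real k) / B)" if n: "n \<ge> k" for n
  proof -
    obtain V :: "nat set" and E and f :: "nat \<Rightarrow> real ^ 'd"
      where V: "uniform_hypergraph k V E" "card V = n" "convex_embedding k V E f"
        and E: "card E = max_edges TYPE('d) k n"
      by (rule max_edges_attained[where k=k and n=n and 'd='d])
    have "cliques k V E r = {}"
    proof (rule ccontr)
      assume "cliques k V E r \<noteq> {}"
      then obtain T where T: "T \<in> cliques k V E r" by blast
      have "finite T" using cliqueD(1)[OF T] V finite_subset unfolding uniform_hypergraph_def by blast
      moreover have "convex_embedding k T {e. e \<subseteq> T \<and> card e = k} f"
        by (rule convex_embedding_subset[OF V(3)]) (use cliqueD[OF T] in auto)
      ultimately show False
        using no_convex_embedding_complete[of k T f] k k1 d1 cliqueD(2)[OF T] by (simp add: r_def)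
    qed
    from de_Caen[OF V(1) k1 kr _ this] n have "real (max_edges TYPE('d) k n) \<le> real (n choose k) *
        (1 - (1 + real n - real r) / (1 + real n - real k) / B)"
      by (simp add: V E B_def r_def algebra_simps)
    then have "real (max_edges TYPE('d) k n) / real n ^ k \<le> real (n choose k) *
        (1 - (1 + real n - real r) / (1 + real n - real k) / B) / real n ^ k"
      by (intro divide_right_mono) auto
    then show ?thesis by simp
  qed
  moreover have "(\<lambda>n. real (n choose k) / real n ^ k * (1 - (1 + real n - real r) / (1 + real n - real k) / B))
      \<longlonglongrightarrow> 1 / fact k * (1 - 1 / B)"
  proof (intro tendsto_mult choose_over_power_tendsto tendsto_diff tendsto_divide tendsto_const)
    have "(\<lambda>n. 1 - (real r - real k) * inverse (1 - real k + real n)) \<longlonglongrightarrow> 1 - (real r - real k) * 0"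
      by (intro tendsto_diff tendsto_mult tendsto_const tendsto_inverse_0_at_top
          filterlim_tendsto_add_at_top[OF tendsto_const] filterlim_real_sequentially)
    then have "(\<lambda>n. 1 - (real r - real k) * inverse (1 - real k + real n)) \<longlonglongrightarrow> 1" by simp
    then show "(\<lambda>n. (1 + real n - real r) / (1 + real n - real k)) \<longlonglongrightarrow> 1"
      by (rule Lim_transform_eventually)
        (use eventually_ge_at_top[of k] in eventually_elim, auto simp: field_simps)
    show "B \<noteq> 0" unfolding B_def using kr by (simp add: r_def)
  qed
  ultimately show ?thesis
    unfolding B_def[symmetric] by (intro LIMSEQ_le[OF lim]) auto
qed

text \<open>The transversal construction with the largest admissible \<open>l\<close>, namely
  \<open>CARD('d) - 1\<close>, padded by a fixed number \<open>t\<close> of common vertices.\<close>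

lemma max_edges_bigomega:
  assumes k: "k \<ge> 1" "CARD('d::finite) \<le> k"
  shows "(\<lambda>n. real (max_edges TYPE('d) k n)) \<in> \<Omega>(\<lambda>n. real n ^ (CARD('d) - 1))"
proof -
  let ?d = "CARD('d)"
  define l where "l = ?d - 1"
  define t where "t = k - l"
  have d: "?d > 0" by simp
  have "(\<lambda>n. real (max_edges TYPE('d) k n)) \<in> \<Omega>(\<lambda>n. real n ^ l)"
  proof (rule landau_omega.bigI)
    show "(1 / (2 * real ?d)) ^ l > 0" by simp
    show "\<forall>\<^sub>F n in sequentially. norm (real (max_edges TYPE('d) k n)) \<ge> (1 / (2 * real ?d)) ^ l * norm (real n ^ l)"
      \<comment> \<open>From here on \<open>t + ?d\<close> is at most half of \<open>n\<close>, so
        padding and rounding still leave \<open>q\<close> at least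
        \<open>n / (2 * ?d)\<close>.\<close>
      using eventually_ge_at_top[of "2 * (t + ?d)"]
    proof eventually_elim
      case (elim n)
      define q where "q = (n - t) div ?d"
      have "n - t < (q + 1) * ?d"
        unfolding q_def using d by (metis add.commute dividend_less_div_times mult.commute mult_Suc plus_1_eq_Suc)
      then have "n < q * ?d + ?d + t" using elim by simp
      then have "real n < real q * real ?d + real ?d + real t" by (metis of_nat_add of_nat_less_iff of_nat_mult)
      moreover have "2 * (real t + real ?d) \<le> real n" using elim by (metis of_nat_add of_nat_le_iff of_nat_mult of_nat_numeral)
      moreover have "x \<le> 2 * y" if "x < y + b + c" "2 * (c + b) \<le> x" for x y b c :: real
        using that by (simp add: algebra_simps)
      ultimately have "real n \<le> 2 * (real q * real ?d)" by blast
      then have "1 / (2 * real ?d) * real n \<le> real q" using d by (simp add: field_simps)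
      then have "(1 / (2 * real ?d) * real n) ^ l \<le> real q ^ l" by (intro power_mono) auto
      also have "real q ^ l \<le> real ((?d choose l) * q ^ l)"
      proof -
        have "?d choose l \<ge> 1" unfolding l_def by (simp add: Suc_le_eq)
        then have "1 * q ^ l \<le> (?d choose l) * q ^ l" by (rule mult_right_mono) simp
        then show ?thesis by (metis mult_1 of_nat_le_iff of_nat_power)
      qed
      also have "\<dots> \<le> real (max_edges TYPE('d) k n)"
      proof -
        have "k = l + t" "l < ?d" "t \<le> n" using k d elim by (simp_all add: t_def l_def)
        then show ?thesis unfolding q_def using k(1) by (intro of_nat_mono max_edges_ge_transversals)
      qed
      finally show ?case by (simp add: power_mult_distrib power_divide)
    qed
  qed
  then show ?thesis unfolding l_def .
qed

theorem theorem1p3: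
  fixes k d :: nat
  assumes "k \<ge> 1" and "d \<ge> 1" and "CARD('d::finite) = d"
  shows "(d \<ge> 2 * k \<longrightarrow> (\<forall>n. max_edges TYPE('d) k n = n choose k))
    \<and> (k + 1 \<le> d \<and> d \<le> 2 * k - 1 \<longrightarrow>
         (\<lambda>n. real (max_edges TYPE('d) k n)) \<in> \<Theta>(\<lambda>n. real n ^ k) \<and>
         (\<exists>\<gamma>::real.
            (\<lambda>n. real (max_edges TYPE('d) k n) - \<gamma> * real n ^ k) \<in> o(\<lambda>n. real n ^ k) \<and>
            real (d choose k) * (1 / real d ^ k) \<le> \<gamma> \<and>
            \<gamma> \<le> 1 / fact k * (1 - 1 / real (n_kd k d choose (k - 1)))))
    \<and> (d \<le> k \<longrightarrow>
         (\<lambda>n. real (max_edges TYPE('d) k n)) \<in> \<Omega>(\<lambda>n. real n ^ (d - 1)))"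
proof (intro conjI impI allI)
  fix n assume "d \<ge> 2 * k"
  then show "max_edges TYPE('d) k n = n choose k"
    using assms by (intro max_edges_high_dim) auto
next
  assume "d \<le> k"
  then show "(\<lambda>n. real (max_edges TYPE('d) k n)) \<in> \<Omega>(\<lambda>n. real n ^ (d - 1))"
    using max_edges_bigomega[of k, where 'd='d] assms by auto
next
  assume kd: "k + 1 \<le> d \<and> d \<le> 2 * k - 1"
  let ?m = "\<lambda>n. real (max_edges TYPE('d) k n)"
  obtain \<gamma> where lim: "(\<lambda>n. ?m n / real n ^ k) \<longlonglongrightarrow> \<gamma>"
    by (rule max_edges_density_convergent[where k=k and 'd='d])
  have lower: "real (d choose k) * (1 / real d ^ k) \<le> \<gamma>"
    using density_ge[OF lim] assms kd by auto
  have upper: "\<gamma> \<le> 1 / fact k * (1 - 1 / real (n_kd k d choose (k - 1)))"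
    using density_le[OF lim] assms kd by auto
  have nz: "\<forall>\<^sub>F n in sequentially. real n ^ k \<noteq> 0"
    using eventually_gt_at_top[of 0] by eventually_elim simp
  \<comment> \<open>As \<open>k < d\<close>, the lower bound is positive; a nonzero limit of the
    quotient is what gives the two-sided order \<open>n^k\<close>.\<close>
  have "0 < real (d choose k) * (1 / real d ^ k)" using kd by simp
  then have "\<gamma> \<noteq> 0" using lower by simp
  then show "?m \<in> \<Theta>(\<lambda>n. real n ^ k)"
    using lim nz by (intro bigthetaI_tendsto)
  have "(\<lambda>n. ?m n / real n ^ k - \<gamma>) \<longlonglongrightarrow> 0"
    using lim by (simp add: LIM_zero)
  then have "(\<lambda>n. (?m n - \<gamma> * real n ^ k) / real n ^ k) \<longlonglongrightarrow> 0"
    by (rule Lim_transform_eventually) (use nz in eventually_elim, auto simp: diff_divide_distrib)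
  then have "(\<lambda>n. ?m n - \<gamma> * real n ^ k) \<in> o(\<lambda>n. real n ^ k)"
    using nz by (intro smalloI_tendsto)
  with lower upper show "\<exists>\<gamma>. (\<lambda>n. ?m n - \<gamma> * real n ^ k) \<in> o(\<lambda>n. real n ^ k) \<and>
      real (d choose k) * (1 / real d ^ k) \<le> \<gamma> \<and>
      \<gamma> \<le> 1 / fact k * (1 - 1 / real (n_kd k d choose (k - 1)))"
    by blast
qed

end
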